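(* Let $f_1:\mathbb{R}\to\mathbb{R}$ be an even function with $f_1\in L_1(\mathbb{R}_+)\cap C_0(\mathbb{R}_+)\cap AC_{loc}(0,+\infty)$, $$\int_0^\infty(t+1)|f_1'(t)|\,dt<\infty,$$ and such that the integral $\int_{\to0}^1\frac{f_1'(t)}{t}\,dt$ converges (not necessarily absolutely). Let $f_0$ be the function on $\mathbb{R}_+$ given by $f_0(t)=-\int_t^\infty\frac{f_1'(u)}{u}\,du$ (improper at $0$ when $t=0$), so that $f_1(x)=|x|f_0(|x|)+\int_{|x|}^\infty f_0(t)\,dt=-\int_{|x|}^\infty tf_0'(t)\,dt$, and let $f(x_1,x_2)=f_0(\max\{|x_1|,|x_2|\})$. (i) If $\widehat f_1(y)\ge0$ for all $y\in\mathbb{R}$, then $\widehat f(y)\ge0$ for all $y\in\mathbb{R}^2$. (ii) If $\widehat f_1(y)>0$ for all $y\in\mathbb{R}$ and $\int_0^\infty tf_1'(t)\,dt<0$, then $\widehat f(y)>0$ for all $y\in\mathbb{R}^2$. The condition $\int_0^\infty tf_1'(t)\,dt<0$ is also necessary for $\widehat f$ to be positive everywhere on $\mathbb{R}^2$.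
   Context: $\mathbb{R}_+=[0,+\infty)$; membership of $f_1$ in the listed spaces refers to its restriction to $\mathbb{R}_+$. $C_0(\mathbb{R}_+)$ denotes continuous functions on $\mathbb{R}_+$ tending to $0$ at $+\infty$; $AC_{loc}(0,+\infty)$ denotes functions absolutely continuous on every compact subinterval of $(0,+\infty)$. The notation $\int_{\to0}^1$ means $\lim_{\varepsilon\to+0}\int_\varepsilon^1$. Fourier transforms: $\widehat h(y)=\int_{\mathbb{R}^d}h(x)e^{-i(x,y)}\,dx$ for $h\in L_1(\mathbb{R}^d)$ ($d=1,2$), with $(x,y)=\sum_k x_ky_k$. *)

theory Defs
  imports "HOL-Analysis.Analysis"
begin

text \<open>
  Absolute continuity of a function on \<open>[a, b]\<close>, by finite families of pairwise
  non-overlapping subintervals \<open>[u i, v i]\<close>. (The library constant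
  \<open>absolutely_continuous\<close> is about measures.)
\<close>

definition abs_cont_on_interval :: "real \<Rightarrow> real \<Rightarrow> (real \<Rightarrow> real) \<Rightarrow> bool" where
  "abs_cont_on_interval a b g \<longleftrightarrow>
     (\<forall>\<epsilon>>0. \<exists>\<delta>>0. \<forall>(n::nat) (u :: nat \<Rightarrow> real) (v :: nat \<Rightarrow> real).
        (\<forall>i<n. a \<le> u i \<and> u i \<le> v i \<and> v i \<le> b) \<longrightarrow>
        (\<forall>i<n. \<forall>j<n. i \<noteq> j \<longrightarrow> {u i<..<v i} \<inter> {u j<..<v j} = {}) \<longrightarrow>
        (\<Sum>i<n. v i - u i) < \<delta> \<longrightarrow>
        (\<Sum>i<n. \<bar>g (v i) - g (u i)\<bar>) < \<epsilon>)"

definition AC_loc_pos :: "(real \<Rightarrow> real) \<Rightarrow> bool" where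
  "AC_loc_pos g \<longleftrightarrow> (\<forall>a b. 0 < a \<longrightarrow> a \<le> b \<longrightarrow> abs_cont_on_interval a b g)"

text \<open>
  For \<open>h\<close> that is not integrable the value is the default \<open>0\<close> of the Bochner integral,
  so integrability has to be stated separately.
  The order on \<^typ>\<open>complex\<close> is the one of \<^theory>\<open>HOL-Library.Complex_Order\<close>:
  \<open>0 \<le> z\<close> means that \<open>z\<close> is real and nonnegative, likewise \<open>0 < z\<close>.
\<close>

definition fourier :: "('a::euclidean_space \<Rightarrow> real) \<Rightarrow> 'a \<Rightarrow> complex" where
  "fourier h y = (LINT x|lebesgue. complex_of_real (h x) * exp (- \<i> * complex_of_real (x \<bullet> y)))"

end

theory Submission
  imports Defs
begin

text \<open>
  Both functions are superpositions of centred indicators. Since \<open>f1\<close> is absolutely continuous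
  and vanishes at infinity, \<open>f1 x\<close> is minus the integral of \<open>f1' u\<close> over \<open>u > \<bar>x\<bar>\<close>, so
  \<open>f1\<close> superposes the intervals \<open>(-u, u)\<close> with density \<open>- f1' u\<close>; in the same way \<open>f\<close>
  superposes the squares \<open>(-u, u) \<times> (-u, u)\<close> with density \<open>- f1' u / u\<close>. Write
  \<open>S u y = 2 sin (u y) / y\<close> for the Fourier transform of the interval. By Fubini
  (\<open>superposition_Fubini\<close>) the transform of \<open>f1\<close> at \<open>y\<close> is the integral of
  \<open>- f1' u S u y\<close>, and that of \<open>f\<close> at \<open>(y1, y2)\<close> is the integral of
  \<open>- (f1' u / u) S u y1 S u y2\<close>.
  
  The link between the two is the product formula
  \<open>2 sin (u y1) sin (u y2) = cos (u (y1 - y2)) - cos (u (y1 + y2))\<close>, whose right-hand side is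
  \<open>u\<close> times the integral of \<open>sin (u s)\<close> over \<open>y1 - y2 < s < y1 + y2\<close>. It turns the
  formula for \<open>f\<close> into: \<open>y1 y2\<close> times the transform of \<open>f\<close> at \<open>(y1, y2)\<close> is the
  integral of \<open>s\<close> times the transform of \<open>f1\<close> at \<open>s\<close> over that interval
  (\<open>square_transform_eq_average\<close>). By symmetry one may take \<open>0 \<le> y2 \<le> y1\<close>; then \<open>s\<close> is
  positive on the interval, and (strict) positivity passes from \<open>f1\<close> to \<open>f\<close>
  (\<open>square_transform_positivity\<close>). On the axis \<open>y2 = 0\<close> the transform of \<open>f\<close> is twice that
  of \<open>f1\<close>, and at the origin it is \<open>-4\<close> times the first moment of \<open>f1'\<close>, which makes
  the moment condition necessary.
  
  The real-variable input is that a locally absolutely continuous function is differentiable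
  almost everywhere and is the integral of its derivative. Differentiability comes directly from
  Vitali's covering theorem. If the slopes near every point of a set of positive outer measure
  oscillated between two values, a disjoint family of intervals with small slopes could be refined
  by intervals with large slopes that cover almost the same measure; absolute continuity makes
  the increment over the leftover gaps negligible, so that the same total increment would be both
  small and large (\<open>negligible_oscillating_slopes\<close>). The integral formula then follows from
  the gauge definition of the integral, with absolute continuity controlling the tags in the null
  set where the derivative fails to exist (\<open>fundamental_theorem_of_calculus_abs_cont\<close>).
\<close>

section \<open>Increments over finite families of intervals\<close>

lemma abs_cont_division:
  assumes ac: "abs_cont_on_interval a b g" and "\<epsilon> > 0"
  obtains \<delta> where "\<delta> > 0"
    "\<And>D S. \<lbrakk>D division_of S; S \<subseteq> {a..b}; (\<Sum>K\<in>D. measure lebesgue K) < \<delta>\<rbrakk> \<Longrightarrow>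
       (\<Sum>K\<in>D. \<bar>g (Sup K) - g (Inf K)\<bar>) < \<epsilon>"
proof -
  from ac \<open>\<epsilon> > 0\<close> obtain \<delta> where "\<delta> > 0"
    and \<delta>: "\<And>(n::nat) (u :: nat \<Rightarrow> real) (v :: nat \<Rightarrow> real).
        \<lbrakk>\<forall>i<n. a \<le> u i \<and> u i \<le> v i \<and> v i \<le> b;
         \<forall>i<n. \<forall>j<n. i \<noteq> j \<longrightarrow> {u i<..<v i} \<inter> {u j<..<v j} = {};
         (\<Sum>i<n. v i - u i) < \<delta>\<rbrakk> \<Longrightarrow> (\<Sum>i<n. \<bar>g (v i) - g (u i)\<bar>) < \<epsilon>"
    unfolding abs_cont_on_interval_def by (elim allE[of _ \<epsilon>] impE exE conjE) auto
  show thesis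
  proof (rule that[OF \<open>\<delta> > 0\<close>])
    fix D S assume D: "D division_of S" and S: "S \<subseteq> {a..b}" and small: "(\<Sum>K\<in>D. measure lebesgue K) < \<delta>"
    have K: "a \<le> Inf K \<and> Inf K \<le> Sup K \<and> Sup K \<le> b"
      and intK: "interior K = {Inf K<..<Sup K}" and mK: "Sup K - Inf K = measure lebesgue K"
      if KD: "K \<in> D" for K
    proof -
      obtain c d where c: "K = cbox c d" "K \<noteq> {}" "K \<subseteq> S"
        using division_ofD(2-4)[OF D KD] by blast
      then have cd: "c \<le> d" "K = {c..d}" by auto
      moreover have "{c..d} \<subseteq> {a..b}" using c(3) S cd by blast
      ultimately have "a \<le> c" "d \<le> b" by auto
      with cd show "a \<le> Inf K \<and> Inf K \<le> Sup K \<and> Sup K \<le> b"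
        "interior K = {Inf K<..<Sup K}" "Sup K - Inf K = measure lebesgue K"
        by (simp_all only: cSup_atLeastAtMost cInf_atLeastAtMost interior_atLeastAtMost_real measure_completion) (simp_all add: cd)
    qed
    obtain h where h: "bij_betw h {..<card D} D"
      using ex_bij_betw_nat_finite[OF division_of_finite[OF D]] by (auto simp: atLeast0LessThan)
    have hD: "h i \<in> D" if "i < card D" for i
      using h that by (auto simp: bij_betw_def)
    have re: "(\<Sum>i<card D. \<phi> (h i)) = (\<Sum>K\<in>D. \<phi> K)" for \<phi> :: "real set \<Rightarrow> real"
      by (rule sum.reindex_bij_betw[OF h])
    have "(\<Sum>i<card D. \<bar>g (Sup (h i)) - g (Inf (h i))\<bar>) < \<epsilon>"
    proof (rule \<delta>)
      show "\<forall>i<card D. a \<le> Inf (h i) \<and> Inf (h i) \<le> Sup (h i) \<and> Sup (h i) \<le> b"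
        using K[OF hD] by blast
      show "\<forall>i<card D. \<forall>j<card D. i \<noteq> j \<longrightarrow>
          {Inf (h i)<..<Sup (h i)} \<inter> {Inf (h j)<..<Sup (h j)} = {}"
      proof (intro allI impI)
        fix i j assume ij: "i < card D" "j < card D" "i \<noteq> j"
        then have "h i \<noteq> h j" using h by (auto simp: bij_betw_def inj_on_def)
        then have "interior (h i) \<inter> interior (h j) = {}"
          using division_ofD(5)[OF D hD hD] ij by blast
        then show "{Inf (h i)<..<Sup (h i)} \<inter> {Inf (h j)<..<Sup (h j)} = {}"
          using intK[OF hD] ij by simp
      qed
      have "(\<Sum>K\<in>D. Sup K - Inf K) = (\<Sum>K\<in>D. measure lebesgue K)"
        using mK by (intro sum.cong refl)
      then show "(\<Sum>i<card D. Sup (h i) - Inf (h i)) < \<delta>"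
        using small re[of "\<lambda>K. Sup K - Inf K"] by simp
    qed
    then show "(\<Sum>K\<in>D. \<bar>g (Sup K) - g (Inf K)\<bar>) < \<epsilon>"
      using re[of "\<lambda>K. \<bar>g (Sup K) - g (Inf K)\<bar>"] by simp
  qed
qed

lemma sum_increments_division:
  fixes g :: "real \<Rightarrow> real"
  assumes "D division_of {a..b}" "a \<le> b"
  shows "(\<Sum>K\<in>D. g (Sup K) - g (Inf K)) = g b - g a"
proof -
  let ?f = "(\<lambda>K::real set. if K = {} then 0 else g(interval_upperbound K) - g(interval_lowerbound K))"
  interpret operative_real plus 0 ?f
    rewrites "comm_monoid_set.F (+) 0 = sum"
    by standard[1] (auto simp add: sum_def)
  have "(\<Sum>K\<in>D. ?f K) = ?f {a..b}"
    by (rule division[OF assms(1)])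
  moreover have "?f K = g (Sup K) - g (Inf K)" if KD: "K \<in> D" for K
  proof -
    obtain c d where "K = cbox c d" "K \<noteq> {}"
      using division_ofD(3,4)[OF assms(1) KD] by blast
    then show ?thesis by auto
  qed
  ultimately show ?thesis using assms by simp
qed

text \<open>
  The covering theorem in the form in which it is used below. The countable family that it provides
  is cut down to a finite one, the interior replaces the closed intervals, and everything
  that is lost is collected in a set of small measure.
\<close>

lemma vitali_finite_intervals:
  fixes E :: "real set"
  assumes fine: "\<And>x d. \<lbrakk>x \<in> E; d > 0\<rbrakk> \<Longrightarrow> \<exists>u v. u < v \<and> u \<le> x \<and> x \<le> v \<and> v - u < d \<and> P u v"
    and sub: "\<And>u v. P u v \<Longrightarrow> {u..v} \<subseteq> {a..b}" and "\<eta> > 0"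
  obtains D T where "finite D" "pairwise disjnt D"
    "\<forall>K\<in>D. \<exists>u v. u < v \<and> P u v \<and> K = {u..v}"
    "E \<subseteq> (\<Union>K\<in>D. interior K) \<union> T" "T \<in> lmeasurable" "measure lebesgue T < \<eta>"
proof -
  define I where "I = {(u,v). u < v \<and> P u v}"
  define ctr :: "real \<times> real \<Rightarrow> real" where "ctr = (\<lambda>(u,v). (u+v)/2)"
  define rad :: "real \<times> real \<Rightarrow> real" where "rad = (\<lambda>(u,v). (v-u)/2)"
  have cb: "cball (ctr i) (rad i) = {fst i..snd i}" for i
    by (cases i) (auto simp: ctr_def rad_def cball_eq_atLeastAtMost field_simps)
  have vit: "\<exists>i. i \<in> I \<and> x \<in> cball (ctr i) (rad i) \<and> rad i < d" if xd: "x \<in> E" "d > 0" for x d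
  proof -
    obtain u v where "u < v \<and> u \<le> x \<and> x \<le> v \<and> v - u < d \<and> P u v" using fine[OF xd] by blast
    then show ?thesis
      by (intro exI[of _ "(u,v)"]) (auto simp: I_def rad_def ctr_def dist_real_def abs_if field_simps)
  qed
  have rad0: "0 < rad i" if "i \<in> I" for i
    using that by (auto simp: I_def rad_def)
  obtain C where C: "countable C" "C \<subseteq> I"
     and disj: "pairwise (\<lambda>i j. disjnt (cball (ctr i) (rad i)) (cball (ctr j) (rad j))) C"
     and neg: "negligible(E - (\<Union>i \<in> C. cball (ctr i) (rad i)))"
    by (rule Vitali_covering_theorem_cballs[of I rad E ctr, OF rad0 vit])
  define N where "N = E - (\<Union>i \<in> C. {fst i..snd i})"
  have N: "negligible N" using neg by (simp add: cb N_def)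
  define F where "F = (\<lambda>i. {fst i..snd i}) ` C"
  have cF: "countable F" using C(1) by (simp add: F_def)
  have FI: "\<exists>u v. u < v \<and> P u v \<and> K = {u..v}" if "K \<in> F" for K
    using that C(2) by (auto simp: I_def F_def)
  have Fsub: "K \<subseteq> {a..b}" if KF: "K \<in> F" for K
  proof -
    obtain u v where "P u v" "K = {u..v}" using FI[OF KF] by blast
    then show ?thesis using sub[of u v] by simp
  qed
  have Fdisj: "pairwise disjnt F"
    using disj unfolding cb F_def pairwise_image by (rule pairwise_mono) auto
  have Flm: "K \<in> lmeasurable" if KF: "K \<in> F" for K
    using FI[OF KF] by auto
  have UFlm: "\<Union>F \<in> lmeasurable"
  proof (rule fmeasurableI2[of "{a..b}"])
    show "\<Union>F \<in> sets lebesgue" using cF Flm by (intro sets.countable_Union) (auto dest: fmeasurableD)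
  qed (use Fsub in auto)
  obtain D where D: "D \<subseteq> F" "finite D" "measure lebesgue (\<Union>F) - \<eta> < measure lebesgue (\<Union>D)"
  proof (rule measure_countable_Union_approachable[of F \<eta> "measure lebesgue {a..b}"])
    fix D' assume "D' \<subseteq> F" "finite D'"
    then have "\<Union>D' \<in> lmeasurable" "\<Union>D' \<subseteq> {a..b}"
      using Flm Fsub by (intro fmeasurable.finite_Union Union_least, blast+)
    then show "measure lebesgue (\<Union>D') \<le> measure lebesgue {a..b}"
      by (intro measure_mono_fmeasurable) auto
  qed (use cF Flm \<open>\<eta> > 0\<close> in auto)
  have UD: "\<Union>D \<in> lmeasurable" using D Flm by (intro fmeasurable.finite_Union) auto
  define X where "X = (\<Union>K\<in>D. K - interior K)"
  have X: "negligible X"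
    unfolding X_def
  proof (rule negligible_Union[OF finite_imageI[OF D(2)], unfolded ball_simps])
    fix t assume "t \<in> (\<lambda>K. K - interior K) ` D"
    then obtain u v :: real where "t = {u..v} - {u<..<v}" using FI D(1) by (metis interior_atLeastAtMost_real subsetD imageE)
    then have "t \<subseteq> {u, v}" by auto
    then show "negligible t" by (meson finite.intros finite_subset negligible_finite)
  qed
  define T where "T = (\<Union>F - \<Union>D) \<union> (N \<union> X)"
  show thesis
  proof
    show "finite D" by fact
    show "pairwise disjnt D" using Fdisj D(1) pairwise_subset by blast
    show "\<forall>K\<in>D. \<exists>u v. u < v \<and> P u v \<and> K = {u..v}" using FI D(1) by blast
    show "E \<subseteq> (\<Union>K\<in>D. interior K) \<union> T"
      unfolding T_def X_def N_def F_def by blast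
    have d: "\<Union>F - \<Union>D \<in> lmeasurable" using UFlm UD by (intro fmeasurable_Diff) (auto dest: fmeasurableD)
    moreover have nx: "negligible (N \<union> X)" using N X by (rule negligible_Un)
    ultimately show "T \<in> lmeasurable" unfolding T_def
      by (intro fmeasurable.Un) (auto intro: negligible_imp_measurable)
    have "measure lebesgue T = measure lebesgue (\<Union>F - \<Union>D)"
      unfolding T_def using d nx by (simp add: measure_Un_null_set negligible_iff_null_sets fmeasurableD)
    also have "\<dots> = measure lebesgue (\<Union>F) - measure lebesgue (\<Union>D)"
      using UFlm UD D(1) by (intro measurable_measure_Diff) auto
    finally show "measure lebesgue T < \<eta>" using D(3) by linarith
  qed
qed

section \<open>Differentiability almost everywhere\<close>

text \<open>
  The set in question need not be measurable, so its outer measure \<open>s\<close> enters only through its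
  two defining properties: lower bound for measurable supersets, approximation by open supersets.
\<close>

lemma negligible_if_no_positive_outer_measure:
  fixes E :: "real set"
  assumes sub: "E \<subseteq> {a<..<b}"
    and pos: "\<And>s. \<lbrakk>s > 0; \<And>T. \<lbrakk>T \<in> lmeasurable; E \<subseteq> T\<rbrakk> \<Longrightarrow> s \<le> measure lebesgue T;
        \<And>\<eta>. \<eta> > 0 \<Longrightarrow> \<exists>U. open U \<and> E \<subseteq> U \<and> U \<subseteq> {a<..<b} \<and> measure lebesgue U < s + \<eta>\<rbrakk> \<Longrightarrow> False"
  shows "negligible E"
proof -
  define A where "A = {measure lebesgue T |T. T \<in> lmeasurable \<and> E \<subseteq> T}"
  have "{a<..<b} \<in> lmeasurable" by (rule lmeasurable_open) auto
  then have A0: "measure lebesgue {a<..<b} \<in> A" unfolding A_def using sub by blast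
  have bdd: "bdd_below A" by (rule bdd_belowI[of _ 0]) (auto simp: A_def)
  have le: "Inf A \<le> measure lebesgue T" if "T \<in> lmeasurable" "E \<subseteq> T" for T
    using that by (intro cInf_lower[OF _ bdd]) (auto simp: A_def)
  have outer: "\<exists>T. T \<in> lmeasurable \<and> E \<subseteq> T \<and> measure lebesgue T < Inf A + \<eta>" if eta: "\<eta> > 0" for \<eta>
  proof -
    have "\<exists>x\<in>A. x < Inf A + \<eta>"
      using cInf_lessD[of A "Inf A + \<eta>"] A0 that by auto
    then show ?thesis by (auto simp: A_def)
  qed
  show ?thesis
  proof (cases "Inf A \<le> 0")
    case True
    show ?thesis unfolding negligible_outer
    proof (intro allI impI)
      fix e :: real assume "e > 0"
      then obtain T where "T \<in> lmeasurable" "E \<subseteq> T" "measure lebesgue T < Inf A + e"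
        using outer by blast
      then show "\<exists>T. E \<subseteq> T \<and> T \<in> lmeasurable \<and> measure lebesgue T < e"
        using True by (intro exI[of _ T]) auto
    qed
  next
    case False
    have "\<exists>U. open U \<and> E \<subseteq> U \<and> U \<subseteq> {a<..<b} \<and> measure lebesgue U < Inf A + \<eta>" if eta: "\<eta> > 0" for \<eta>
    proof -
      obtain T where T: "T \<in> lmeasurable" "E \<subseteq> T" "measure lebesgue T < Inf A + \<eta>/2"
        using outer[of "\<eta>/2"] eta by auto
      obtain V where V: "open V" "T \<subseteq> V" "V - T \<in> lmeasurable" "emeasure lebesgue (V - T) < ennreal (\<eta>/2)"
        using sets_lebesgue_outer_open[of T "\<eta>/2"] T eta by (auto dest: fmeasurableD)
      have VT: "measure lebesgue (V - T) < \<eta>/2"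
        using V(3,4) that by (simp add: emeasure_eq_measure2 ennreal_less_iff)
      have "V \<in> lmeasurable"
        using fmeasurable.Un[OF T(1) V(3)] V(2) by (simp add: Un_absorb1)
      moreover have "measure lebesgue V \<le> measure lebesgue T + measure lebesgue (V - T)"
        using measure_Un_le[of T lebesgue "V - T"] T(1) V(2,3) by (simp add: fmeasurableD Un_absorb1)
      moreover have "measure lebesgue (V \<inter> {a<..<b}) \<le> measure lebesgue V" if "V \<in> lmeasurable"
        using that V(1) by (intro measure_mono_fmeasurable) auto
      ultimately have "measure lebesgue (V \<inter> {a<..<b}) < Inf A + \<eta>" using T(3) VT by linarith
      then show ?thesis
        using V(1,2) T(2) sub by (intro exI[of _ "V \<inter> {a<..<b}"]) auto
    qed
    then show ?thesis using pos[of "Inf A"] False le by auto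
  qed
qed

lemma disjnt_intervals_division:
  fixes D :: "real set set"
  assumes "finite D" "pairwise disjnt D" "\<And>K. K \<in> D \<Longrightarrow> \<exists>u v. u < v \<and> P u v \<and> K = {u..v}"
  shows "D division_of \<Union>D"
proof (rule division_ofI)
  show "interior K \<inter> interior L = {}" if "K \<in> D" "L \<in> D" "K \<noteq> L" for K L
    using pairwiseD[OF assms(2) that] interior_subset[of K] interior_subset[of L]
    unfolding disjnt_def by blast
  fix K assume KD: "K \<in> D"
  then show "K \<subseteq> \<Union>D" by blast
  obtain u v where "u < v" "K = {u..v}" using assms(3)[OF KD] by blast
  then show "K \<noteq> {}" "\<exists>a b. K = cbox a b" by (simp, metis box_real(2))
qed (use assms in auto)

text \<open>
  The members of \<open>r\<close> outside \<open>D'\<close> are the gaps left by the finer family; increments are additive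
  over \<open>r\<close> because each interval of \<open>D\<close> is subdivided separately.
\<close>

lemma refine_disjoint_intervals:
  fixes g :: "real \<Rightarrow> real"
  assumes D: "finite D" "pairwise disjnt D" "\<And>K. K \<in> D \<Longrightarrow> \<exists>u v. u < v \<and> K = {u..v}"
    and D': "finite D'" "pairwise disjnt D'" "\<And>K. K \<in> D' \<Longrightarrow> \<exists>u v. u < v \<and> K = {u..v}"
    and ref: "\<And>K. K \<in> D' \<Longrightarrow> \<exists>L\<in>D. K \<subseteq> L"
  obtains r where "D' \<subseteq> r" "r division_of \<Union>D"
    "(\<Sum>K\<in>D. g (Sup K) - g (Inf K)) = (\<Sum>K\<in>r. g (Sup K) - g (Inf K))"
proof -
  have "\<exists>q. {K\<in>D'. K \<subseteq> L} \<subseteq> q \<and> q division_of L" if L: "L \<in> D" for L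
  proof -
    obtain u v where uv: "u < v" "L = {u..v}" using D(3)[OF L] by blast
    have "{K\<in>D'. K \<subseteq> L} division_of \<Union>{K\<in>D'. K \<subseteq> L}"
      using D' pairwise_subset[OF D'(2)]
      by (intro disjnt_intervals_division[where P="\<lambda>_ _. True"]) auto
    then obtain q where "{K\<in>D'. K \<subseteq> L} \<subseteq> q" "q division_of cbox u v"
      using partial_division_extend_interval[of "{K\<in>D'. K \<subseteq> L}" u v] uv by (metis (no_types, lifting) Sup_least box_real(2) mem_Collect_eq)
    then show ?thesis using uv by auto
  qed
  then obtain q where q1: "\<And>L. L \<in> D \<Longrightarrow> {K\<in>D'. K \<subseteq> L} \<subseteq> q L" and q2: "\<And>L. L \<in> D \<Longrightarrow> q L division_of L"
    by metis
  have qD: "K \<noteq> {} \<and> K \<subseteq> L" if "L \<in> D" "K \<in> q L" for K L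
    using division_ofD(2,3)[OF q2[OF that(1)] that(2)] by blast
  define r where "r = (\<Union>L\<in>D. q L)"
  have dq: "q L \<inter> q L' = {}" if "L \<in> D" "L' \<in> D" "L \<noteq> L'" for L L'
  proof -
    have "L \<inter> L' = {}" using D(2) that by (auto simp: pairwise_def disjnt_def)
    then show ?thesis using qD[OF that(1)] qD[OF that(2)] by blast
  qed
  show thesis
  proof
    show "D' \<subseteq> r" using ref q1 by (fastforce simp: r_def)
    show "r division_of \<Union>D"
    proof (rule division_ofI)
      show "finite r" using D(1) division_of_finite[OF q2] by (auto simp: r_def)
      have "\<Union>r = (\<Union>L\<in>D. \<Union>(q L))" by (auto simp: r_def)
      also have "\<dots> = \<Union>D" using division_ofD(6)[OF q2] by simp
      finally show "\<Union>r = \<Union>D" .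
      fix K assume "K \<in> r"
      then obtain L where L: "L \<in> D" "K \<in> q L" by (auto simp: r_def)
      show "K \<subseteq> \<Union>D" "K \<noteq> {}" using qD[OF L] L by auto
      show "\<exists>a b. K = cbox a b" using division_ofD(4)[OF q2[OF L(1)] L(2)] .
      fix K' assume "K' \<in> r" and ne: "K \<noteq> K'"
      then obtain L' where L': "L' \<in> D" "K' \<in> q L'" by (auto simp: r_def)
      show "interior K \<inter> interior K' = {}"
      proof (cases "L = L'")
        case True
        then show ?thesis using division_ofD(5)[OF q2[OF L(1)] L(2)] L' ne by blast
      next
        case False
        then have "L \<inter> L' = {}" using D(2) L L' by (auto simp: pairwise_def disjnt_def)
        then show ?thesis
          using qD[OF L] qD[OF L'] interior_subset[of K] interior_subset[of K'] by blast
      qed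
    qed
    have "(\<Sum>K\<in>r. g (Sup K) - g (Inf K)) = (\<Sum>L\<in>D. \<Sum>K\<in>q L. g (Sup K) - g (Inf K))"
      unfolding r_def using D(1) division_of_finite[OF q2] dq
      by (intro sum.UNION_disjoint) auto
    also have "\<dots> = (\<Sum>K\<in>D. g (Sup K) - g (Inf K))"
    proof (rule sum.cong[OF refl])
      fix L assume L: "L \<in> D"
      then obtain u v where "u < v" "L = {u..v}" using D(3) by blast
      then show "(\<Sum>K\<in>q L. g (Sup K) - g (Inf K)) = g (Sup L) - g (Inf L)"
        using sum_increments_division[of "q L" u v g] q2[OF L] by auto
    qed
    finally show "(\<Sum>K\<in>D. g (Sup K) - g (Inf K)) = (\<Sum>K\<in>r. g (Sup K) - g (Inf K))" ..
  qed
qed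

lemma sum_increments_le_slope:
  fixes g :: "real \<Rightarrow> real"
  assumes "D division_of \<Union>D" "\<And>K. K \<in> D \<Longrightarrow> \<exists>u v. u < v \<and> g v - g u \<le> p * (v - u) \<and> K = {u..v}"
  shows "(\<Sum>K\<in>D. g (Sup K) - g (Inf K)) \<le> p * measure lebesgue (\<Union>D)"
proof -
  have "g (Sup K) - g (Inf K) \<le> p * measure lebesgue K" if "K \<in> D" for K
    using assms(2)[OF that] by auto
  then have "(\<Sum>K\<in>D. g (Sup K) - g (Inf K)) \<le> (\<Sum>K\<in>D. p * measure lebesgue K)"
    by (rule sum_mono)
  then show ?thesis
    using content_division[OF assms(1)] by (simp flip: sum_distrib_left)
qed

text \<open>
  Let \<open>s\<close> be the outer measure of \<open>E\<close>. A finite family \<open>D1\<close> of intervals of slope at most \<open>p\<close>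
  covers \<open>E\<close> up to \<open>\<eta>\<close> and has total length within \<open>\<eta>\<close> of \<open>s\<close>. Inside it a family \<open>D2\<close> of
  intervals of slope at least \<open>q\<close> covers \<open>E\<close> up to \<open>2 \<eta>\<close>. The gaps have total length at most
  \<open>3 \<eta>\<close>, so the increment of \<open>g\<close> over them is below \<open>\<epsilon>\<close>, and comparing the two
  evaluations of the total increment gives \<open>q s \<le> p s\<close> up to an arbitrarily small error.
\<close>

lemma negligible_oscillating_slopes:
  assumes ac: "abs_cont_on_interval a b g" and "p < q" and sub: "E \<subseteq> {a<..<b}"
    and low: "\<And>x d. \<lbrakk>x \<in> E; d > 0\<rbrakk> \<Longrightarrow> \<exists>u v. u < v \<and> u \<le> x \<and> x \<le> v \<and> v - u < d \<and> g v - g u \<le> p * (v - u)"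
    and high: "\<And>x d. \<lbrakk>x \<in> E; d > 0\<rbrakk> \<Longrightarrow> \<exists>u v. u < v \<and> u \<le> x \<and> x \<le> v \<and> v - u < d \<and> g v - g u \<ge> q * (v - u)"
  shows "negligible E"
proof (rule negligible_if_no_positive_outer_measure[OF sub])
  fix s :: real assume s: "s > 0"
    and s_le: "\<And>T. \<lbrakk>T \<in> lmeasurable; E \<subseteq> T\<rbrakk> \<Longrightarrow> s \<le> measure lebesgue T"
    and s_out: "\<And>\<eta>. \<eta> > 0 \<Longrightarrow> \<exists>U. open U \<and> E \<subseteq> U \<and> U \<subseteq> {a<..<b} \<and> measure lebesgue U < s + \<eta>"
  define \<epsilon> where "\<epsilon> = (q - p) * s / 2"
  have "\<epsilon> > 0" using s \<open>p < q\<close> by (simp add: \<epsilon>_def)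
  obtain \<delta> where "\<delta> > 0"
    and \<delta>: "\<And>D S. \<lbrakk>D division_of S; S \<subseteq> {a..b}; (\<Sum>K\<in>D. measure lebesgue K) < \<delta>\<rbrakk> \<Longrightarrow>
       (\<Sum>K\<in>D. \<bar>g (Sup K) - g (Inf K)\<bar>) < \<epsilon>" using abs_cont_division[OF ac \<open>\<epsilon> > 0\<close>] by blast
  \<comment> \<open>The errors below add up to at most \<open>\<epsilon> + (2 \<bar>q\<bar> + \<bar>p\<bar>) \<eta>\<close>, which must stay below \<open>(q - p) s = 2 \<epsilon>\<close>.\<close>
  define M where "M = 2 * \<bar>q\<bar> + \<bar>p\<bar> + 1"
  define \<eta> where "\<eta> = min (\<delta>/4) (\<epsilon> / M)"
  have "M > 0" by (simp add: M_def add_nonneg_pos)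
  have "\<eta> > 0" using \<open>\<delta> > 0\<close> \<open>\<epsilon> > 0\<close> \<open>M > 0\<close> by (simp add: \<eta>_def)
  obtain U where U: "open U" "E \<subseteq> U" "U \<subseteq> {a<..<b}" "measure lebesgue U < s + \<eta>"
    using s_out[OF \<open>\<eta> > 0\<close>] by blast
  have Ulm: "U \<in> lmeasurable" 
    using U(1) bounded_subset[OF _ U(3)] by (intro lmeasurable_open) auto
  have ab: "{a<..<b} \<subseteq> {a..b}" by (rule greaterThanLessThan_subseteq_atLeastAtMost_iff[THEN iffD2]) auto
  have fine1: "\<exists>u v. u < v \<and> u \<le> x \<and> x \<le> v \<and> v - u < d \<and> {u..v} \<subseteq> U \<and> g v - g u \<le> p * (v - u)"
    if x: "x \<in> E" "d > 0" for x d
  proof -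
    obtain e where e: "e > 0" "ball x e \<subseteq> U" using U x by (meson open_contains_ball subsetD)
    obtain u v where uv: "u < v" "u \<le> x" "x \<le> v" "v - u < min d e" "g v - g u \<le> p * (v - u)"
      using low[OF x(1), of "min d e"] x(2) e(1) by auto
    have "{u..v} \<subseteq> ball x e" using uv by (auto simp: dist_real_def)
    then show ?thesis
      using uv e by (intro exI[of _ u] exI[of _ v]) auto
  qed
  have sub1: "{u..v} \<subseteq> {a..b}" if "{u..v} \<subseteq> U \<and> g v - g u \<le> p * (v - u)" for u v
    using that U(3) ab by (meson order_trans)
  obtain D1 T1 where D1a: "finite D1" "pairwise disjnt D1"
    and D1b: "\<forall>K\<in>D1. \<exists>u v. u < v \<and> ({u..v} \<subseteq> U \<and> g v - g u \<le> p * (v - u)) \<and> K = {u..v}"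
    and D1c:     "E \<subseteq> (\<Union>K\<in>D1. interior K) \<union> T1" "T1 \<in> lmeasurable" "measure lebesgue T1 < \<eta>"
    by (rule vitali_finite_intervals[OF fine1 sub1 \<open>\<eta> > 0\<close>])
  note D1 = D1a D1b[rule_format] D1c
  have div1: "D1 division_of \<Union>D1" using D1(1-3) by (rule disjnt_intervals_division)
  have D1U: "\<Union>D1 \<subseteq> U" using D1(3) by blast
  from D1U U(3) ab have D1ab: "\<Union>D1 \<subseteq> {a..b}" by (meson order_trans)
  have fine2: "\<exists>u v. u < v \<and> u \<le> x \<and> x \<le> v \<and> v - u < d \<and> (\<exists>K\<in>D1. {u..v} \<subseteq> K) \<and> g v - g u \<ge> q * (v - u)"
    if x: "x \<in> E \<inter> (\<Union>K\<in>D1. interior K)" "d > 0" for x d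
  proof -
    obtain K where K: "K \<in> D1" "x \<in> interior K" using x by blast
    obtain e where e: "e > 0" "ball x e \<subseteq> K" using K by (meson mem_interior)
    obtain u v where uv: "u < v" "u \<le> x" "x \<le> v" "v - u < min d e" "g v - g u \<ge> q * (v - u)"
      using high[of x "min d e"] x e(1) by auto
    have "{u..v} \<subseteq> ball x e" using uv by (auto simp: dist_real_def)
    then show ?thesis
      using uv e K by (intro exI[of _ u] exI[of _ v]) auto
  qed
  have sub2: "{u..v} \<subseteq> {a..b}" if "(\<exists>K\<in>D1. {u..v} \<subseteq> K) \<and> g v - g u \<ge> q * (v - u)" for u v
    using that D1ab by blast
  obtain D2 T2 where D2a: "finite D2" "pairwise disjnt D2"
    and D2b: "\<forall>K\<in>D2. \<exists>u v. u < v \<and> ((\<exists>K\<in>D1. {u..v} \<subseteq> K) \<and> g v - g u \<ge> q * (v - u)) \<and> K = {u..v}"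
    and D2c:     "E \<inter> (\<Union>K\<in>D1. interior K) \<subseteq> (\<Union>K\<in>D2. interior K) \<union> T2" "T2 \<in> lmeasurable" "measure lebesgue T2 < \<eta>"
    by (rule vitali_finite_intervals[OF fine2 sub2 \<open>\<eta> > 0\<close>])
  note D2 = D2a D2b[rule_format] D2c
  have div2: "D2 division_of \<Union>D2" using D2(1-3) by (rule disjnt_intervals_division)
  define m1 where "m1 = measure lebesgue (\<Union>D1)"
  define m2 where "m2 = measure lebesgue (\<Union>D2)"
  have lm: "\<Union>D1 \<in> lmeasurable" "\<Union>D2 \<in> lmeasurable"
    using div1 div2 by (auto intro: lmeasurable_division)
  have "\<Union>D2 \<subseteq> \<Union>D1" using D2(3) by blast
  have m21: "m2 \<le> m1" unfolding m1_def m2_def using \<open>\<Union>D2 \<subseteq> \<Union>D1\<close> lm by (intro measure_mono_fmeasurable) auto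
  have m1U: "m1 \<le> s + \<eta>"
    using measure_mono_fmeasurable[of "\<Union>D1" U lebesgue] D1U lm Ulm U(4) by (auto simp: m1_def)
  have int_sub: "(\<Union>K\<in>D. interior K) \<subseteq> \<Union>D" for D :: "real set set"
    using interior_subset by blast
  have "E \<subseteq> \<Union>D1 \<union> T1" using D1(4) int_sub[of D1] by blast
  have "s \<le> measure lebesgue (\<Union>D1 \<union> T1)"
    using \<open>E \<subseteq> \<Union>D1 \<union> T1\<close> lm(1) D1(5) by (intro s_le fmeasurable.Un)
  also have "\<dots> \<le> m1 + measure lebesgue T1"
    using lm(1) D1(5) by (auto simp: m1_def intro!: measure_Un_le)
  finally have sm1: "s \<le> m1 + \<eta>" using D1(6) by linarith
  have "E \<subseteq> \<Union>D2 \<union> (T1 \<union> T2)" using D1(4) D2(4) int_sub[of D2] by blast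
  then have "s \<le> measure lebesgue (\<Union>D2 \<union> (T1 \<union> T2))"
    using lm(2) D1(5) D2(5) by (intro s_le fmeasurable.Un)
  also have "\<dots> \<le> m2 + measure lebesgue (T1 \<union> T2)"
    using lm(2) D1(5) D2(5) by (auto simp: m2_def intro!: measure_Un_le)
  also have "measure lebesgue (T1 \<union> T2) \<le> measure lebesgue T1 + measure lebesgue T2"
    using D1(5) D2(5) by (auto intro!: measure_Un_le)
  finally have sm2: "s \<le> m2 + 2 * \<eta>" using D1(6) D2(6) by linarith
  have e1: "\<exists>u v. u < v \<and> K = {u..v}" if "K \<in> D1" for K using D1(3)[OF that] by blast
  have e2: "\<exists>u v. u < v \<and> K = {u..v}" if "K \<in> D2" for K using D2(3)[OF that] by blast
  have ref: "\<exists>L\<in>D1. K \<subseteq> L" if "K \<in> D2" for K using D2(3)[OF that] by blast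
  obtain r where r: "D2 \<subseteq> r" "r division_of \<Union>D1"
    and incr: "(\<Sum>K\<in>D1. g (Sup K) - g (Inf K)) = (\<Sum>K\<in>r. g (Sup K) - g (Inf K))"
    by (rule refine_disjoint_intervals[OF D1(1,2) e1 D2(1,2) e2 ref])
  have "finite r" using r(2) by (rule division_of_finite)
  have gap: "r - D2 division_of \<Union>(r - D2)"
    by (rule division_of_subset[OF division_of_union_self[OF r(2)]]) blast
  have "(\<Sum>K\<in>r - D2. measure lebesgue K) = m1 - m2"
    using content_division[OF r(2)] content_division[OF div2] \<open>finite r\<close> r(1)
    by (simp add: sum_diff m1_def m2_def)
  also have "\<dots> < \<delta>"
    using m1U sm2 \<open>\<delta> > 0\<close> by (simp add: \<eta>_def min_def split: if_splits)
  finally have "(\<Sum>K\<in>r - D2. \<bar>g (Sup K) - g (Inf K)\<bar>) < \<epsilon>"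
  proof (intro \<delta>[OF gap])
    have "\<Union>(r - D2) \<subseteq> \<Union>r" by blast
    also have "\<dots> = \<Union>D1" using r(2) by (rule division_ofD)
    finally show "\<Union>(r - D2) \<subseteq> {a..b}" using D1ab by (meson order_trans)
  qed
  moreover have "\<bar>\<Sum>K\<in>r - D2. g (Sup K) - g (Inf K)\<bar> \<le> (\<Sum>K\<in>r - D2. \<bar>g (Sup K) - g (Inf K)\<bar>)"
    by (rule sum_abs)
  moreover have "(\<Sum>K\<in>r. g (Sup K) - g (Inf K)) =
      (\<Sum>K\<in>r - D2. g (Sup K) - g (Inf K)) + (\<Sum>K\<in>D2. g (Sup K) - g (Inf K))"
    using sum.subset_diff[OF r(1) \<open>finite r\<close>] by blast
  moreover have "(\<Sum>K\<in>D1. g (Sup K) - g (Inf K)) \<le> p * m1"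
    unfolding m1_def using D1(3) by (intro sum_increments_le_slope[OF div1]) blast
  moreover have "(\<Sum>K\<in>D2. - g (Sup K) - - g (Inf K)) \<le> (-q) * m2"
    unfolding m2_def using D2(3) by (intro sum_increments_le_slope[OF div2]) fastforce
  then have "q * m2 \<le> (\<Sum>K\<in>D2. g (Sup K) - g (Inf K))"
    by (simp add: sum_subtractf sum_negf)
  ultimately have main: "q * m2 - \<epsilon> < p * m1" using incr by linarith
  have "\<bar>q * (s - m2)\<bar> \<le> \<bar>q\<bar> * (2 * \<eta>)"
    unfolding abs_mult using sm2 m21 m1U \<open>\<eta> > 0\<close> by (intro mult_left_mono) auto
  moreover have "\<bar>p * (s - m1)\<bar> \<le> \<bar>p\<bar> * \<eta>"
    unfolding abs_mult using sm1 m1U \<open>\<eta> > 0\<close> by (intro mult_left_mono) auto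
  ultimately have "(q - p) * s < \<epsilon> + (2 * \<bar>q\<bar> + \<bar>p\<bar>) * \<eta>"
    using main by (simp add: algebra_simps)
  also have "(2 * \<bar>q\<bar> + \<bar>p\<bar>) * \<eta> \<le> M * \<eta>"
    using \<open>\<eta> > 0\<close> by (simp add: M_def)
  also have "M * \<eta> \<le> M * (\<epsilon> / M)"
    using \<open>M > 0\<close> by (intro mult_left_mono) (auto simp: \<eta>_def)
  also have "\<dots> = \<epsilon>" using \<open>M > 0\<close> by simp
  finally show False by (simp add: \<epsilon>_def)
qed

text \<open>
  This excludes infinite derivatives. On a ball of radius less than half the \<open>\<delta>\<close> that absolute
  continuity assigns to \<open>1\<close>, every disjoint family of intervals has total variation below \<open>1\<close>, so a
  family of slopes at least \<open>2/e\<close> has total length below \<open>e/2\<close>.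
\<close>

lemma negligible_unbounded_slopes:
  assumes ac: "abs_cont_on_interval a b g" and sub: "E \<subseteq> {a<..<b}"
    and steep: "\<And>x M d. \<lbrakk>x \<in> E; d > 0\<rbrakk> \<Longrightarrow>
        \<exists>u v. u < v \<and> u \<le> x \<and> x \<le> v \<and> v - u < d \<and> M * (v - u) \<le> \<bar>g v - g u\<bar>"
  shows "negligible E"
proof -
  obtain \<delta> where "\<delta> > 0"
    and \<delta>: "\<And>D S. \<lbrakk>D division_of S; S \<subseteq> {a..b}; (\<Sum>K\<in>D. measure lebesgue K) < \<delta>\<rbrakk> \<Longrightarrow>
       (\<Sum>K\<in>D. \<bar>g (Sup K) - g (Inf K)\<bar>) < 1" using abs_cont_division[OF ac zero_less_one] by blast
  have loc: "negligible (E \<inter> ball z (\<delta>/3))" for z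
    unfolding negligible_outer_le
  proof (intro allI impI)
    fix e :: real assume "e > 0"
    define V where "V = ball z (\<delta>/3) \<inter> {a<..<b}"
    have "open V" by (auto simp: V_def)
    have "V \<subseteq> {a..b}" by (auto simp: V_def)
    have fine: "\<exists>u v. u < v \<and> u \<le> x \<and> x \<le> v \<and> v - u < d \<and> {u..v} \<subseteq> V \<and> 2/e * (v - u) \<le> \<bar>g v - g u\<bar>"
      if x: "x \<in> E \<inter> ball z (\<delta>/3)" "d > 0" for x d
    proof -
      have "x \<in> V" using x sub by (auto simp: V_def)
      then obtain r where r: "r > 0" "ball x r \<subseteq> V" using \<open>open V\<close> by (meson open_contains_ball)
      obtain u v where uv: "u < v" "u \<le> x" "x \<le> v" "v - u < min d r" "2/e * (v - u) \<le> \<bar>g v - g u\<bar>"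
        using steep[of x "min d r" "2/e"] x r(1) by auto
      have "{u..v} \<subseteq> ball x r" using uv by (auto simp: dist_real_def)
      then show ?thesis using uv r by (intro exI[of _ u] exI[of _ v]) auto
    qed
    have subV: "{u..v} \<subseteq> {a..b}" if "{u..v} \<subseteq> V \<and> 2/e * (v - u) \<le> \<bar>g v - g u\<bar>" for u v
      using that \<open>V \<subseteq> {a..b}\<close> by (meson order_trans)
    have "e/2 > 0" using \<open>e > 0\<close> by simp
    obtain D T where Da: "finite D" "pairwise disjnt D"
      and Db: "\<forall>K\<in>D. \<exists>u v. u < v \<and> ({u..v} \<subseteq> V \<and> 2/e * (v - u) \<le> \<bar>g v - g u\<bar>) \<and> K = {u..v}"
      and Dc: "E \<inter> ball z (\<delta>/3) \<subseteq> (\<Union>K\<in>D. interior K) \<union> T" "T \<in> lmeasurable" "measure lebesgue T < e/2"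
      by (rule vitali_finite_intervals[OF fine subV \<open>e/2 > 0\<close>])
    have div: "D division_of \<Union>D" by (rule disjnt_intervals_division[OF Da Db[rule_format]])
    have DV: "\<Union>D \<subseteq> V" using Db by blast
    have lmD: "\<Union>D \<in> lmeasurable" using div by (rule lmeasurable_division)
    have "measure lebesgue (\<Union>D) \<le> measure lebesgue {z - \<delta>/3..z + \<delta>/3}"
    proof (rule measure_mono_fmeasurable)
      show "\<Union>D \<subseteq> {z - \<delta>/3..z + \<delta>/3}" 
      proof
        fix x assume "x \<in> \<Union>D"
        then have "\<bar>z - x\<bar> < \<delta>/3" using DV by (auto simp: V_def dist_real_def)
        then have "z - \<delta>/3 \<le> x" "x \<le> z + \<delta>/3" by linarith+
        then show "x \<in> {z - \<delta>/3..z + \<delta>/3}" by simp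
      qed
    qed (use lmD in auto)
    also have "\<dots> < \<delta>" using \<open>\<delta> > 0\<close> by simp
    finally have "(\<Sum>K\<in>D. \<bar>g (Sup K) - g (Inf K)\<bar>) < 1"
      using DV \<open>V \<subseteq> {a..b}\<close> by (intro \<delta>[OF div]) (auto simp: content_division[OF div])
    moreover have "2/e * measure lebesgue (\<Union>D) \<le> (\<Sum>K\<in>D. \<bar>g (Sup K) - g (Inf K)\<bar>)"
    proof -
      have "2/e * measure lebesgue K \<le> \<bar>g (Sup K) - g (Inf K)\<bar>" if "K \<in> D" for K
      proof -
        obtain u v where "u < v" "2/e * (v - u) \<le> \<bar>g v - g u\<bar>" "K = {u..v}" using Db \<open>K \<in> D\<close> by blast
        then show ?thesis by simp
      qed
      then have "(\<Sum>K\<in>D. 2/e * measure lebesgue K) \<le> (\<Sum>K\<in>D. \<bar>g (Sup K) - g (Inf K)\<bar>)"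
        by (rule sum_mono)
      then show ?thesis by (simp only: content_division[OF div] flip: sum_distrib_left)
    qed
    ultimately have "2/e * measure lebesgue (\<Union>D) < 1" by linarith
    then have "measure lebesgue (\<Union>D) < e/2" using \<open>e > 0\<close> by (simp add: field_simps)
    moreover have "measure lebesgue (\<Union>D \<union> T) \<le> measure lebesgue (\<Union>D) + measure lebesgue T"
      using lmD Dc(2) by (intro measure_Un_le) (auto dest: fmeasurableD)
    moreover have "(\<Union>K\<in>D. interior K) \<subseteq> \<Union>D" using interior_subset by blast
    then have "E \<inter> ball z (\<delta>/3) \<subseteq> \<Union>D \<union> T" using Dc(1) by blast
    ultimately show "\<exists>T. E \<inter> ball z (\<delta>/3) \<subseteq> T \<and> T \<in> lmeasurable \<and> measure lebesgue T \<le> e"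
      using lmD Dc(2,3) by (intro exI[of _ "\<Union>D \<union> T"] conjI fmeasurable.Un) auto
  qed
  show ?thesis
  proof (subst locally_negligible_alt, intro ballI)
    fix z assume "z \<in> E"
    then show "\<exists>U. openin (top_of_set E) U \<and> z \<in> U \<and> negligible U"
      using loc[of z] \<open>\<delta> > 0\<close> by (intro exI[of _ "E \<inter> ball z (\<delta>/3)"]) (auto intro: openin_open_Int)
  qed
qed

text \<open>
  The lower and upper limits of the difference quotient are finite, and if they differed, two
  rationals between them would witness an oscillation. Rational bounds matter because the caller
  takes a countable union over the pairs \<open>(p, q)\<close>.
\<close>

lemma differentiable_of_bounded_nonoscillating_slopes:
  fixes g :: "real \<Rightarrow> real"
  assumes bd: "d > 0" "\<And>y. \<lbrakk>y \<noteq> x; \<bar>y - x\<bar> < d\<rbrakk> \<Longrightarrow> \<bar>(g y - g x) / (y - x)\<bar> \<le> M"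
    and osc: "\<And>p q. \<lbrakk>p \<in> \<rat>; q \<in> \<rat>; p < q;
        \<And>e. e > 0 \<Longrightarrow> \<exists>y. y \<noteq> x \<and> \<bar>y - x\<bar> < e \<and> (g y - g x) / (y - x) \<le> p;
        \<And>e. e > 0 \<Longrightarrow> \<exists>y. y \<noteq> x \<and> \<bar>y - x\<bar> < e \<and> (g y - g x) / (y - x) \<ge> q\<rbrakk> \<Longrightarrow> False"
  shows "g differentiable (at x)"
proof -
  define \<phi> where "\<phi> y = (g y - g x) / (y - x)" for y
  define l where "l = Liminf (at x) (\<lambda>y. ereal (\<phi> y))"
  define L where "L = Limsup (at x) (\<lambda>y. ereal (\<phi> y))"
  have ev: "eventually (\<lambda>y. \<bar>\<phi> y\<bar> \<le> M) (at x)"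
    unfolding eventually_at using bd by (auto simp: \<phi>_def dist_real_def)
  have "ereal (-M) \<le> l" unfolding l_def
    by (rule Liminf_bounded) (use ev in \<open>eventually_elim, auto\<close>)
  have "L \<le> ereal M" unfolding L_def
    by (rule Limsup_bounded) (use ev in \<open>eventually_elim, auto\<close>)
  have "l \<le> L" unfolding l_def L_def by (rule Liminf_le_Limsup) simp
  have "\<not> l < L"
  proof
    assume "l < L"
    then obtain q' where q': "l < ereal q'" "ereal q' < L" using ereal_dense2 by blast
    obtain p' where p': "l < ereal p'" "ereal p' < ereal q'" using ereal_dense2[OF q'(1)] by blast
    then obtain p where p: "p \<in> \<rat>" "p' < p" "p < q'" using Rats_dense_in_real[of p' q'] by auto
    obtain q where q: "q \<in> \<rat>" "p < q" "q < q'" using Rats_dense_in_real[of p q'] p by auto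
    have "\<not> eventually (\<lambda>y. p \<le> \<phi> y) (at x)"
    proof
      assume "eventually (\<lambda>y. p \<le> \<phi> y) (at x)"
      then have 1: "ereal p \<le> l" unfolding l_def
        by (intro Liminf_bounded) (simp add: eventually_mono)
      have "l < ereal p" using p'(1) p(2) by (meson ereal_less_eq(3) less_eq_real_def less_le_trans)
      with 1 show False by simp
    qed
    then have 1: "\<exists>y. y \<noteq> x \<and> \<bar>y - x\<bar> < e \<and> \<phi> y \<le> p" if "e > 0" for e
      using that unfolding eventually_at dist_real_def by (metis UNIV_I le_cases)
    have "\<not> eventually (\<lambda>y. \<phi> y \<le> q) (at x)"
    proof
      assume "eventually (\<lambda>y. \<phi> y \<le> q) (at x)"
      then have 1: "L \<le> ereal q" unfolding L_def
        by (intro Limsup_bounded) (simp add: eventually_mono)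
      have "ereal q < L" using q(3) q'(2) by (meson ereal_less_eq(3) less_eq_real_def le_less_trans)
      with 1 show False by simp
    qed
    then have 2: "\<exists>y. y \<noteq> x \<and> \<bar>y - x\<bar> < e \<and> \<phi> y \<ge> q" if "e > 0" for e
      using that unfolding eventually_at dist_real_def by (metis UNIV_I le_cases)
    show False using osc[OF p(1) q(1,2)] 1 2 unfolding \<phi>_def by blast
  qed
  then have "l = L" using \<open>l \<le> L\<close> by simp
  moreover have "\<bar>l\<bar> \<noteq> \<infinity>" using \<open>ereal (-M) \<le> l\<close> \<open>L \<le> ereal M\<close> \<open>l = L\<close> by auto
  ultimately obtain D where D: "l = ereal D" "L = ereal D" by (cases l) auto
  have "((\<lambda>y. ereal (\<phi> y)) \<longlongrightarrow> ereal D) (at x)"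
    using D by (intro Liminf_eq_Limsup) (auto simp: l_def L_def)
  then have "(\<phi> \<longlongrightarrow> D) (at x)" by simp
  then have "(g has_field_derivative D) (at x)"
    unfolding has_field_derivative_iff \<phi>_def[abs_def] by simp
  then show ?thesis unfolding real_differentiable_def by blast
qed

lemma abs_cont_imp_ae_differentiable:
  assumes ac: "abs_cont_on_interval a b g"
  shows "negligible {x \<in> {a<..<b}. \<not> g differentiable (at x)}"
proof -
  define B where "B = {x \<in> {a<..<b}. \<forall>M d. d > 0 \<longrightarrow>
        (\<exists>u v. u < v \<and> u \<le> x \<and> x \<le> v \<and> v - u < d \<and> M * (v - u) \<le> \<bar>g v - g u\<bar>)}"
  define Osc where "Osc p q = {x \<in> {a<..<b}.
      (\<forall>d>0. \<exists>u v. u < v \<and> u \<le> x \<and> x \<le> v \<and> v - u < d \<and> g v - g u \<le> p * (v - u)) \<and>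
      (\<forall>d>0. \<exists>u v. u < v \<and> u \<le> x \<and> x \<le> v \<and> v - u < d \<and> g v - g u \<ge> q * (v - u))}" for p q
  have "negligible B"
    by (rule negligible_unbounded_slopes[OF ac]) (auto simp: B_def)
  have nO: "negligible (Osc p q)" if "p < q" for p q
    by (rule negligible_oscillating_slopes[OF ac that]) (auto simp: Osc_def)
  let ?R = "{(p,q). p \<in> \<rat> \<and> q \<in> \<rat> \<and> p < q} :: (real \<times> real) set"
  have "countable ?R"
    by (rule countable_subset[of _ "\<rat> \<times> \<rat>"]) (auto intro: countable_rat)
  then have "negligible (\<Union>(p,q)\<in>?R. Osc p q)"
    using nO by (intro negligible_countable_Union) auto
  with \<open>negligible B\<close> have "negligible (B \<union> (\<Union>(p,q)\<in>?R. Osc p q))" by (rule negligible_Un)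
  moreover have "{x \<in> {a<..<b}. \<not> g differentiable (at x)} \<subseteq> B \<union> (\<Union>(p,q)\<in>?R. Osc p q)"
  proof (intro subsetI, rule ccontr)
    fix x assume x: "x \<in> {x \<in> {a<..<b}. \<not> g differentiable (at x)}"
      and nx: "x \<notin> B \<union> (\<Union>(p,q)\<in>?R. Osc p q)"
    \<comment> \<open>A difference quotient is the slope over the interval between \<open>x\<close> and \<open>y\<close>, on whichever side \<open>y\<close> lies.\<close>
    have iv: "\<exists>u v. u < v \<and> u \<le> x \<and> x \<le> v \<and> v - u = \<bar>y - x\<bar> \<and> g v - g u = (g y - g x) / (y - x) * (v - u)"
      if "y \<noteq> x" for y
      using that by (intro exI[of _ "min x y"] exI[of _ "max x y"]) (auto simp: min_def max_def field_simps)
    from x nx have "\<not> (\<forall>M d. d > 0 \<longrightarrow>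
        (\<exists>u v. u < v \<and> u \<le> x \<and> x \<le> v \<and> v - u < d \<and> M * (v - u) \<le> \<bar>g v - g u\<bar>))"
      by (simp add: B_def)
    then obtain M d where d: "d > 0"
      and nM: "\<not> (\<exists>u v. u < v \<and> u \<le> x \<and> x \<le> v \<and> v - u < d \<and> M * (v - u) \<le> \<bar>g v - g u\<bar>)"
      by blast
    have M: "\<bar>g v - g u\<bar> < M * (v - u)" if "u < v" "u \<le> x" "x \<le> v" "v - u < d" for u v
      using nM that by (meson not_le)
    have "g differentiable (at x)"
    proof (rule differentiable_of_bounded_nonoscillating_slopes[OF d, where M = M])
      fix y assume y: "y \<noteq> x" "\<bar>y - x\<bar> < d"
      obtain u v where uv: "u < v" "u \<le> x" "x \<le> v" "v - u = \<bar>y - x\<bar>" "g v - g u = (g y - g x) / (y - x) * (v - u)"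
        using iv[OF y(1)] by blast
      have *: "\<bar>(g y - g x) / (y - x)\<bar> * (v - u) < M * (v - u)"
        using M[OF uv(1-3)] uv(1,4) y(2) unfolding uv(5) abs_mult by simp
      have "\<bar>(g y - g x) / (y - x)\<bar> < M"
        by (rule mult_right_less_imp_less[OF *]) (use uv(1) in simp)
      then show "\<bar>(g y - g x) / (y - x)\<bar> \<le> M" by simp
    next
      fix p q :: real
      assume pq: "p \<in> \<rat>" "q \<in> \<rat>" "p < q"
        and low: "\<And>e. e > 0 \<Longrightarrow> \<exists>y. y \<noteq> x \<and> \<bar>y - x\<bar> < e \<and> (g y - g x) / (y - x) \<le> p"
        and high: "\<And>e. e > 0 \<Longrightarrow> \<exists>y. y \<noteq> x \<and> \<bar>y - x\<bar> < e \<and> (g y - g x) / (y - x) \<ge> q"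
      have "\<exists>u v. u < v \<and> u \<le> x \<and> x \<le> v \<and> v - u < e \<and> g v - g u \<le> p * (v - u)" if "e > 0" for e
      proof -
        obtain y where y: "y \<noteq> x" "\<bar>y - x\<bar> < e" "(g y - g x) / (y - x) \<le> p" using low[OF \<open>e > 0\<close>] by blast
        obtain u v where uv: "u < v" "u \<le> x" "x \<le> v" "v - u = \<bar>y - x\<bar>" "g v - g u = (g y - g x) / (y - x) * (v - u)"
          using iv[OF y(1)] by blast
        have "g v - g u \<le> p * (v - u)" unfolding uv(5) using y(3) uv(1) by (intro mult_right_mono) auto
        then show ?thesis using uv y(2) by (intro exI[of _ u] exI[of _ v]) simp
      qed
      moreover have "\<exists>u v. u < v \<and> u \<le> x \<and> x \<le> v \<and> v - u < e \<and> g v - g u \<ge> q * (v - u)" if "e > 0" for e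
      proof -
        obtain y where y: "y \<noteq> x" "\<bar>y - x\<bar> < e" "(g y - g x) / (y - x) \<ge> q" using high[OF \<open>e > 0\<close>] by blast
        obtain u v where uv: "u < v" "u \<le> x" "x \<le> v" "v - u = \<bar>y - x\<bar>" "g v - g u = (g y - g x) / (y - x) * (v - u)"
          using iv[OF y(1)] by blast
        have "g v - g u \<ge> q * (v - u)" unfolding uv(5) using y(3) uv(1) by (intro mult_right_mono) auto
        then show ?thesis using uv y(2) by (intro exI[of _ u] exI[of _ v]) simp
      qed
      ultimately have "x \<in> Osc p q" using x by (simp add: Osc_def)
      then show False using nx pq by blast
    qed
    with x show False by simp
  qed
  ultimately show ?thesis by (rule negligible_subset)
qed

section \<open>The fundamental theorem of calculus\<close>

text \<open>
  A tagged division may repeat a degenerate interval under several tags. Such intervals have no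
  increment, which is why the sum over tagged intervals equals the sum over the intervals.
\<close>

lemma abs_cont_tagged_variation_small:
  fixes g :: "real \<Rightarrow> real"
  assumes \<delta>: "\<And>D S. \<lbrakk>D division_of S; S \<subseteq> {a..b}; (\<Sum>K\<in>D. measure lebesgue K) < \<delta>\<rbrakk> \<Longrightarrow>
       (\<Sum>K\<in>D. \<bar>g (Sup K) - g (Inf K)\<bar>) < \<epsilon>"
    and p: "p tagged_partial_division_of {a..b}" and sub: "\<Union>(snd ` p) \<subseteq> U"
    and U: "U \<in> lmeasurable" "measure lebesgue U < \<delta>"
  shows "(\<Sum>(x,K)\<in>p. \<bar>g (Sup K) - g (Inf K)\<bar>) < \<epsilon>"
proof -
  define S where "S = \<Union>(snd ` p)"
  have pS: "p tagged_division_of S"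
    unfolding S_def by (rule tagged_partial_division_of_Union_self[OF p])
  have div: "snd ` p division_of S" by (rule division_of_tagged_division[OF pS])
  have "S \<subseteq> {a..b}" using tagged_partial_division_ofD(3)[OF p] by (force simp: S_def)
  moreover have "(\<Sum>K\<in>snd ` p. measure lebesgue K) \<le> measure lebesgue U"
    unfolding content_division[OF div]
    using sub U lmeasurable_division[OF div] by (intro measure_mono_fmeasurable) (auto simp: S_def)
  ultimately have "(\<Sum>K\<in>snd ` p. \<bar>g (Sup K) - g (Inf K)\<bar>) < \<epsilon>"
    using U(2) by (intro \<delta>[OF div]) auto
  moreover have "(\<Sum>K\<in>snd ` p. if interior K = {} then 0 else \<bar>g (Sup K) - g (Inf K)\<bar>) =
      (\<Sum>K\<in>snd ` p. \<bar>g (Sup K) - g (Inf K)\<bar>)"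
  proof (rule sum.cong[OF refl])
    fix K assume K: "K \<in> snd ` p"
    obtain c d where cd: "K = cbox c d" "K \<noteq> {}" using division_ofD(3,4)[OF div K] by blast
    then have "c \<le> d" "K = {c..d}" by auto
    then show "(if interior K = {} then 0 else \<bar>g (Sup K) - g (Inf K)\<bar>) = \<bar>g (Sup K) - g (Inf K)\<bar>"
      by auto
  qed
  moreover have "(\<Sum>(x,K)\<in>p. if interior K = {} then 0 else \<bar>g (Sup K) - g (Inf K)\<bar>) =
      (\<Sum>K\<in>snd ` p. if interior K = {} then 0 else \<bar>g (Sup K) - g (Inf K)\<bar>)"
    by (rule sum.over_tagged_division_lemma[OF pS]) (simp only: interior_cbox simp_thms if_True)
  moreover have "(\<Sum>(x,K)\<in>p. if interior K = {} then 0 else \<bar>g (Sup K) - g (Inf K)\<bar>) =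
      (\<Sum>(x,K)\<in>p. \<bar>g (Sup K) - g (Inf K)\<bar>)"
  proof (rule sum.cong[OF refl], clarify)
    fix x K assume K: "(x,K) \<in> p"
    have "x \<in> K" "\<exists>c d. K = cbox c d"
      using tagged_partial_division_ofD(2,4)[OF p K] by auto
    then obtain c d where "c \<le> d" "K = {c..d}" by auto
    then show "(if interior K = {} then 0 else \<bar>g (Sup K) - g (Inf K)\<bar>) = \<bar>g (Sup K) - g (Inf K)\<bar>"
      by auto
  qed
  ultimately show ?thesis by simp
qed

text \<open>
  In the Riemann sum of a fine tagged division, the intervals tagged off \<open>N\<close> approximate the
  increments of \<open>g\<close> by differentiability. The derivative is set to \<open>0\<close> on \<open>N\<close>, and the gauge
  forces the intervals tagged in \<open>N\<close> into an open set of small measure, where absolute continuity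
  bounds the sum of the increments.
\<close>

lemma fundamental_theorem_of_calculus_abs_cont:
  assumes ac: "abs_cont_on_interval a b g" and "a \<le> b" and N: "negligible N"
    and der: "\<And>x. x \<in> {a..b} - N \<Longrightarrow> (g has_real_derivative g' x) (at x)"
  shows "(g' has_integral g b - g a) {a..b}"
proof -
  define h where "h x = (if x \<in> N then 0 else g' x)" for x
  have "(h has_integral g b - g a) {a..b}"
    unfolding has_integral_real
  proof (intro allI impI)
    fix e :: real assume "e > 0"
    then have "e/2 > 0" by simp
    obtain \<delta> where "\<delta> > 0"
      and \<delta>: "\<And>D S. \<lbrakk>D division_of S; S \<subseteq> {a..b}; (\<Sum>K\<in>D. measure lebesgue K) < \<delta>\<rbrakk> \<Longrightarrow>
         (\<Sum>K\<in>D. \<bar>g (Sup K) - g (Inf K)\<bar>) < e/2" using abs_cont_division[OF ac \<open>e/2 > 0\<close>] by blast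
    obtain U where U: "open U" "N \<subseteq> U" "U \<in> lmeasurable" "measure lebesgue U < \<delta>"
    proof -
      obtain V where V: "open V" "N \<subseteq> V" "V - N \<in> lmeasurable" "emeasure lebesgue (V - N) < ennreal \<delta>"
        using sets_lebesgue_outer_open[OF negligible_imp_sets[OF N] \<open>\<delta> > 0\<close>] by blast
      have "V = (V - N) \<union> N" using V(2) by blast
      then have "V \<in> lmeasurable" "measure lebesgue V = measure lebesgue (V - N)"
        using V(3) N by (metis fmeasurable.Un negligible_imp_measurable)
          (metis V(3) N \<open>V = (V - N) \<union> N\<close> fmeasurableD measure_Un_null_set negligible_iff_null_sets)
      moreover have "measure lebesgue (V - N) < \<delta>"
        using V(3,4) \<open>\<delta> > 0\<close> by (simp add: emeasure_eq_measure2 ennreal_less_iff)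
      ultimately show thesis using that V(1,2) by simp
    qed
    \<comment> \<open>The summand \<open>1\<close> keeps the denominator positive when \<open>a = b\<close>.\<close>
    define \<eta> where "\<eta> = e / (2 * (b - a + 1))"
    have "\<eta> > 0" using \<open>e > 0\<close> \<open>a \<le> b\<close> by (simp add: \<eta>_def)
    have "\<exists>d>0. \<forall>y. \<bar>y - x\<bar> < d \<longrightarrow> \<bar>g y - g x - g' x * (y - x)\<bar> \<le> \<eta> * \<bar>y - x\<bar>"
      if "x \<in> {a..b} - N" for x
    proof -
      have "(g has_derivative (\<lambda>h. g' x * h)) (at x)"
        using der[OF that] by (simp add: has_field_derivative_def)
      then show ?thesis using \<open>\<eta> > 0\<close> unfolding has_derivative_at_alt by auto
    qed
    then obtain d where d0: "\<And>x. x \<in> {a..b} - N \<Longrightarrow> d x > 0"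
      and d: "\<And>x y. \<lbrakk>x \<in> {a..b} - N; \<bar>y - x\<bar> < d x\<rbrakk> \<Longrightarrow> \<bar>g y - g x - g' x * (y - x)\<bar> \<le> \<eta> * \<bar>y - x\<bar>"
      by metis
    define \<gamma> where "\<gamma> x = (if x \<in> N then U else if x \<in> {a..b} then ball x (d x) else ball x 1)" for x
    have gg: "gauge \<gamma>"
      unfolding gauge_def \<gamma>_def using U(1,2) d0 by auto
    have fg: "norm ((\<Sum>(x,K)\<in>p. measure lborel K *\<^sub>R h x) - (g b - g a)) < e"
      if p: "p tagged_division_of {a..b}" and fine: "\<gamma> fine p" for p
    proof -
      let ?G = "\<lambda>K. g (Sup K) - g (Inf K)"
      have fp: "finite p" using p by (rule tagged_division_of_finite)
      have pp: "p tagged_partial_division_of {a..b}"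
        using p by (simp add: tagged_division_of_def)
      have incr: "(\<Sum>(x,K)\<in>p. ?G K) = g b - g a"
        by (rule additive_tagged_division_1[OF \<open>a \<le> b\<close> p])
      define pN where "pN = {(x,K) \<in> p. x \<in> N}"
      have pNp: "pN \<subseteq> p" by (auto simp: pN_def)
      have "(\<Sum>(x,K)\<in>pN. \<bar>?G K\<bar>) < e/2"
      proof (rule abs_cont_tagged_variation_small[OF \<delta> tagged_partial_division_subset[OF pp pNp] _ U(3,4)])
        show "\<Union>(snd ` pN) \<subseteq> U"
        proof
          fix z assume "z \<in> \<Union>(snd ` pN)"
          then obtain x K where xK: "(x,K) \<in> p" "x \<in> N" "z \<in> K" by (auto simp: pN_def)
          then have "K \<subseteq> \<gamma> x" using fine by (auto simp: fine_def)
          then show "z \<in> U" using xK by (auto simp: \<gamma>_def)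
        qed
      qed
      moreover have "(\<Sum>(x,K)\<in>pN. \<bar>measure lborel K *\<^sub>R h x - ?G K\<bar>) = (\<Sum>(x,K)\<in>pN. \<bar>?G K\<bar>)"
        by (rule sum.cong) (auto simp: pN_def h_def)
      moreover have "(\<Sum>(x,K)\<in>p - pN. \<bar>measure lborel K *\<^sub>R h x - ?G K\<bar>) \<le> (\<Sum>(x,K)\<in>p - pN. \<eta> * measure lborel K)"
      proof (rule sum_mono, clarify)
        fix x K assume xK: "(x,K) \<in> p" "(x,K) \<notin> pN"
        have K: "x \<in> K" "K \<subseteq> {a..b}" "\<exists>c d. K = cbox c d"
          using tagged_division_ofD(2-4)[OF p xK(1)] by auto
        then obtain u v where uv: "u \<le> x" "x \<le> v" "K = {u..v}" by auto
        have xN: "x \<in> {a..b} - N" using xK K by (auto simp: pN_def)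
        have "K \<subseteq> ball x (d x)" using fine xK xN by (force simp: fine_def \<gamma>_def)
        moreover have "u \<in> K" "v \<in> K" using uv by auto
        ultimately have "\<bar>u - x\<bar> < d x" "\<bar>v - x\<bar> < d x" by (auto simp: dist_real_def abs_minus_commute)
        then have "\<bar>g u - g x - g' x * (u - x)\<bar> \<le> \<eta> * (x - u)" "\<bar>g v - g x - g' x * (v - x)\<bar> \<le> \<eta> * (v - x)"
          using d[OF xN, of u] d[OF xN, of v] uv by simp_all
        then have "\<bar>(v - u) * g' x - (g v - g u)\<bar> \<le> \<eta> * (v - u)"
          by (simp add: algebra_simps abs_le_iff)
        then show "\<bar>measure lborel K *\<^sub>R h x - ?G K\<bar> \<le> \<eta> * measure lborel K"
          using uv xN by (simp add: h_def)
      qed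
      moreover have "(\<Sum>(x,K)\<in>p - pN. \<eta> * measure lborel K) \<le> (\<Sum>(x,K)\<in>p. \<eta> * measure lborel K)"
        using fp \<open>\<eta> > 0\<close> by (intro sum_mono2) auto
      moreover have "(\<Sum>(x,K)\<in>p. \<eta> * measure lborel K) = \<eta> * (b - a)"
      proof -
        have "(\<Sum>(x,K)\<in>p. measure lborel K) = b - a"
          using additive_content_tagged_division[of p a b] p \<open>a \<le> b\<close> by simp
        then show ?thesis by (simp add: sum_distrib_left[symmetric] split_def)
      qed
      moreover have "\<eta> * (b - a) \<le> e/2"
      proof -
        define c where "c = b - a + 1"
        have "c > 0" "\<eta> = e / (2 * c)" using \<open>a \<le> b\<close> by (simp_all add: c_def \<eta>_def)
        then have "\<eta> * c = e/2" by simp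
        moreover have "\<eta> * (b - a) \<le> \<eta> * c" using \<open>\<eta> > 0\<close> by (simp add: c_def)
        ultimately show ?thesis by simp
      qed
      moreover have "(\<Sum>(x,K)\<in>p. \<bar>measure lborel K *\<^sub>R h x - ?G K\<bar>) =
          (\<Sum>(x,K)\<in>p - pN. \<bar>measure lborel K *\<^sub>R h x - ?G K\<bar>) + (\<Sum>(x,K)\<in>pN. \<bar>measure lborel K *\<^sub>R h x - ?G K\<bar>)"
        by (rule sum.subset_diff[OF pNp fp])
      moreover have "\<bar>\<Sum>(x,K)\<in>p. measure lborel K *\<^sub>R h x - ?G K\<bar> \<le> (\<Sum>(x,K)\<in>p. \<bar>measure lborel K *\<^sub>R h x - ?G K\<bar>)"
        unfolding split_def by (rule sum_abs)
      moreover have "(\<Sum>(x,K)\<in>p. measure lborel K *\<^sub>R h x - ?G K) = (\<Sum>(x,K)\<in>p. measure lborel K *\<^sub>R h x) - (g b - g a)"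
        unfolding incr[symmetric] by (simp add: split_def sum_subtractf)
      ultimately show ?thesis by (simp only: real_norm_def)
    qed
    show "\<exists>\<gamma>. gauge \<gamma> \<and> (\<forall>p. p tagged_division_of {a..b} \<and> \<gamma> fine p \<longrightarrow>
        norm ((\<Sum>(x,K)\<in>p. measure lborel K *\<^sub>R h x) - (g b - g a)) < e)"
    proof (intro exI[of _ \<gamma>] conjI allI impI gg)
      fix p assume "p tagged_division_of {a..b} \<and> \<gamma> fine p"
      then show "norm ((\<Sum>(x,K)\<in>p. measure lborel K *\<^sub>R h x) - (g b - g a)) < e"
        using fg[of p] by (elim conjE)
    qed
  qed
  then show ?thesis
    by (rule has_integral_spike[OF N, rotated]) (simp add: h_def)
qed

lemma AC_loc_pos_ae_differentiable:
  assumes "AC_loc_pos g"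
  shows "negligible {x. 0 < x \<and> \<not> g differentiable (at x)}"
proof -
  have "{x. 0 < x \<and> \<not> g differentiable (at x)} \<subseteq>
     (\<Union>n::nat. {x \<in> {1 / Suc n<..<Suc n}. \<not> g differentiable (at x)})"
  proof
    fix x :: real assume x: "x \<in> {x. 0 < x \<and> \<not> g differentiable (at x)}"
    obtain n :: nat where n: "max x (1/x) < Suc n" using reals_Archimedean2[of "max x (1/x)"] by (metis less_Suc_eq of_nat_less_iff order_less_trans lessI)
    then have "1 / Suc n < x" using x by (simp add: field_simps)
    then show "x \<in> (\<Union>n::nat. {x \<in> {1 / Suc n<..<Suc n}. \<not> g differentiable (at x)})"
      using x n by auto
  qed
  moreover have "negligible (\<Union>n::nat. {x \<in> {1 / Suc n<..<Suc n}. \<not> g differentiable (at x)})"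
  proof (rule negligible_Union_nat)
    fix n :: nat
    have "1 / Suc n \<le> 1" "(1::real) \<le> Suc n" by simp_all
    then have "1 / Suc n \<le> Suc n" by linarith
    then show "negligible {x \<in> {1 / Suc n<..<Suc n}. \<not> g differentiable (at x)}"
      using assms by (intro abs_cont_imp_ae_differentiable) (simp add: AC_loc_pos_def)
  qed
  ultimately show ?thesis by (rule negligible_subset[rotated])
qed

lemma AC_loc_pos_deriv_has_integral:
  assumes "AC_loc_pos g" "0 < a" "a \<le> b"
  shows "(deriv g has_integral g b - g a) {a..b}"
proof (rule fundamental_theorem_of_calculus_abs_cont[OF _ _ AC_loc_pos_ae_differentiable[OF assms(1)]])
  show "abs_cont_on_interval a b g" using assms by (simp add: AC_loc_pos_def)
  show "(g has_real_derivative deriv g x) (at x)"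
    if "x \<in> {a..b} - {x. 0 < x \<and> \<not> g differentiable at x}" for x
    using that assms DERIV_deriv_iff_real_differentiable by auto
qed fact

section \<open>A Borel density for the derivative\<close>

text \<open>
  The derivative is only Lebesgue measurable, whereas Fubini's theorem is applied to the product of
  Borel measures. This lemma moves integrals from one setting to the other.
\<close>

lemma lebesgue_integral_cong_borel:
  fixes \<phi> \<psi> :: "'a::euclidean_space \<Rightarrow> 'b::euclidean_space"
  assumes ae: "AE x in lebesgue. \<phi> x = \<psi> x" and \<psi>: "\<psi> \<in> borel_measurable borel"
  shows integrable_cong_borel: "integrable lebesgue \<phi> \<longleftrightarrow> integrable lborel \<psi>"
    and integral_cong_borel: "integral\<^sup>L lebesgue \<phi> = integral\<^sup>L lborel \<psi>"
proof -
  have \<psi>L: "\<psi> \<in> borel_measurable lebesgue" using \<psi> by (intro measurable_completion) simp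
  have \<phi>L: "\<phi> \<in> borel_measurable lebesgue"
    using \<psi>L by (rule borel_measurable_AE) (use ae in \<open>simp add: eq_commute\<close>)
  have "integrable lebesgue \<phi> \<longleftrightarrow> integrable lebesgue \<psi>"
    by (rule integrable_cong_AE[OF \<phi>L \<psi>L ae])
  then show "integrable lebesgue \<phi> \<longleftrightarrow> integrable lborel \<psi>"
    using \<psi> by (simp add: integrable_completion)
  have "integral\<^sup>L lebesgue \<phi> = integral\<^sup>L lebesgue \<psi>"
    by (rule integral_cong_AE[OF \<phi>L \<psi>L ae])
  then show "integral\<^sup>L lebesgue \<phi> = integral\<^sup>L lborel \<psi>"
    using \<psi> by (simp add: integral_completion)
qed

lemma AC_loc_pos_deriv_measurable:
  assumes "AC_loc_pos g"
  shows "(\<lambda>x. indicator {0<..} x * deriv g x) \<in> borel_measurable lebesgue"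
proof (rule borel_measurable_LIMSEQ_real)
  fix n :: nat
  show "(\<lambda>x. deriv g x * indicator {1 / Suc n..1 / Suc n + Suc n} x) \<in> borel_measurable lebesgue"
    by (rule has_integral_implies_lebesgue_measurable_real)
      (rule AC_loc_pos_deriv_has_integral[OF assms], simp_all)
next
  fix x :: real
  have "eventually (\<lambda>n. indicator {1 / Suc n..1 / Suc n + Suc n} x = (indicator {0<..} x :: real)) sequentially"
  proof (cases "x > 0")
    case True
    obtain N :: nat where N: "max x (1/x) < N" using reals_Archimedean2 by blast
    show ?thesis
    proof (rule eventually_sequentiallyI[of N])
      fix n assume "n \<ge> N"
      then have n: "max x (1/x) < Suc n" using N by (meson less_Suc_eq_le of_nat_less_iff order_less_trans)
      then have "1 / Suc n \<le> x" using True by (simp add: field_simps)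
      moreover have "0 \<le> 1 / real (Suc n)" by simp
      then have "x \<le> 1 / Suc n + Suc n" using n by linarith
      ultimately show "indicator {1 / Suc n..1 / Suc n + Suc n} x = (indicator {0<..} x :: real)"
        using True by simp
    qed
  next
    case False
    have "indicator {1 / Suc n..1 / Suc n + Suc n} x = (indicator {0<..} x :: real)" for n :: nat
    proof -
      have "0 < 1 / real (Suc n)" by simp
      then have "\<not> 1 / Suc n \<le> x" using False by linarith
      then show ?thesis using False by simp
    qed
    then show ?thesis by simp
  qed
  then have "(\<lambda>n. indicator {1 / Suc n..1 / Suc n + Suc n} x) \<longlonglongrightarrow> (indicator {0<..} x :: real)"
    by (rule tendsto_eventually)
  from tendsto_mult[OF tendsto_const this, of "deriv g x"]
  show "(\<lambda>n. deriv g x * indicator {1 / Suc n..1 / Suc n + Suc n} x) \<longlonglongrightarrow> indicator {0<..} x * deriv g x"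
    by (simp add: mult.commute)
qed

text \<open>
  The increment formula on \<open>{a..b}\<close> with \<open>0 < a\<close> is extended by letting \<open>b\<close> tend to infinity,
  where \<open>f1\<close> vanishes, and then \<open>a\<close> to \<open>0\<close>, where \<open>f1\<close> is continuous from the right.
\<close>

lemma borel_deriv_representation:
  fixes f1 :: "real \<Rightarrow> real"
  assumes even: "\<And>x. f1 (- x) = f1 x"
    and C0: "continuous_on {0..} f1" "(f1 \<longlongrightarrow> 0) at_top"
    and AC: "AC_loc_pos f1"
    and weighted: "set_integrable lebesgue {0<..} (\<lambda>t. (t + 1) * \<bar>deriv f1 t\<bar>)"
  obtains h where "h \<in> borel_measurable borel" "\<forall>u\<le>0. h u = 0"
    "integrable lborel h" "integrable lborel (\<lambda>u. u * h u)"
    "AE u in lebesgue. 0 < u \<longrightarrow> deriv f1 u = h u"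
    "\<forall>x. f1 x = - (LINT u|lborel. indicator {\<bar>x\<bar><..} u * h u)"
proof -
  have mL: "(\<lambda>x. indicator {0<..} x * deriv f1 x) \<in> borel_measurable lebesgue"
    by (rule AC_loc_pos_deriv_measurable[OF AC])
  obtain h0 where h0: "h0 \<in> borel_measurable lborel" "AE x in lborel. indicator {0<..} x * deriv f1 x = h0 x"
    using completion_ex_borel_measurable_real[OF mL] by blast
  define h where "h u = indicator {0<..} u * h0 u" for u
  have h[measurable]: "h \<in> borel_measurable borel" using h0(1) by (simp add: h_def[abs_def])
  have h_neg: "h u = 0" if "u \<le> 0" for u using that by (simp add: h_def)
  have ae: "AE u in lebesgue. 0 < u \<longrightarrow> deriv f1 u = h u"
    using AE_completion[OF h0(2)]
  proof eventually_elim
    case (elim u)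
    show ?case
    proof
      assume "0 < u"
      then have "indicator {0<..} u = (1::real)" by simp
      then show "deriv f1 u = h u" using elim by (simp add: h_def)
    qed
  qed
  have w: "integrable lborel (\<lambda>u. (u + 1) * \<bar>h u\<bar>)"
  proof -
    have "AE u in lebesgue. indicator {0<..} u *\<^sub>R ((u + 1) * \<bar>deriv f1 u\<bar>) = (u + 1) * \<bar>h u\<bar>"
      using ae by eventually_elim (auto simp: h_neg indicator_def)
    from integrable_cong_borel[OF this] weighted show ?thesis
      by (simp add: set_integrable_def)
  qed
  have int_h: "integrable lborel h"
  proof (rule Bochner_Integration.integrable_bound[OF w])
    show "AE u in lborel. norm (h u) \<le> norm ((u + 1) * \<bar>h u\<bar>)"
    proof (rule AE_I2)
      fix u :: real
      have "\<bar>h u\<bar> \<le> \<bar>u + 1\<bar> * \<bar>h u\<bar>"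
        by (cases "u \<le> 0") (auto simp: h_neg mult_le_cancel_right1)
      then show "norm (h u) \<le> norm ((u + 1) * \<bar>h u\<bar>)" by (simp add: abs_mult)
    qed
  qed simp
  have int_uh: "integrable lborel (\<lambda>u. u * h u)"
  proof (rule Bochner_Integration.integrable_bound[OF w])
    show "AE u in lborel. norm (u * h u) \<le> norm ((u + 1) * \<bar>h u\<bar>)"
    proof (rule AE_I2)
      fix u :: real
      have "\<bar>u\<bar> * \<bar>h u\<bar> \<le> \<bar>u + 1\<bar> * \<bar>h u\<bar>"
        by (cases "u \<le> 0") (auto simp: h_neg intro: mult_right_mono)
      then show "norm (u * h u) \<le> norm ((u + 1) * \<bar>h u\<bar>)" by (simp add: abs_mult)
    qed
  qed simp
  have incr: "(LINT u|lborel. indicator {a..b} u * h u) = f1 b - f1 a" if "0 < a" "a \<le> b" for a b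
  proof -
    have "AE u in lebesgue. indicator {a..b} u *\<^sub>R deriv f1 u = indicator {a..b} u * h u"
      using ae by eventually_elim (use that in \<open>auto simp: indicator_def\<close>)
    note c = integrable_cong_borel[OF this] integral_cong_borel[OF this]
    have "integrable lborel (\<lambda>u. indicator {a..b} u * h u)"
      using integrable_mult_indicator[OF _ int_h, of "{a..b}"] by simp
    then have "set_integrable lebesgue {a..b} (deriv f1)"
      using c(1) by (simp add: set_integrable_def)
    then have "(LINT u:{a..b}|lebesgue. deriv f1 u) = integral {a..b} (deriv f1)"
      by (rule set_lebesgue_integral_eq_integral)
    also have "\<dots> = f1 b - f1 a"
      using AC_loc_pos_deriv_has_integral[OF AC that] by (rule integral_unique)
    finally show ?thesis using c(2) by (simp add: set_lebesgue_integral_def)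
  qed
  have pos: "f1 a = - (LINT u|lborel. indicator {a<..} u * h u)" if "0 < a" for a
  proof -
    have "integrable lborel (\<lambda>u. indicator {a<..} u * h u)"
      using integrable_mult_indicator[OF _ int_h, of "{a<..}"] by simp
    then have "((\<lambda>b. LINT u|lborel. indicator {..b} u *\<^sub>R (indicator {a<..} u * h u)) \<longlongrightarrow>
        (LINT u|lborel. indicator {a<..} u * h u)) at_top"
      by (intro tendsto_integral_at_top) simp_all
    moreover have "eventually (\<lambda>b. (LINT u|lborel. indicator {..b} u *\<^sub>R (indicator {a<..} u * h u)) = f1 b - f1 a) at_top"
    proof (rule eventually_at_top_linorderI[of a])
      fix b assume "a \<le> b"
      have "(LINT u|lborel. indicator {..b} u *\<^sub>R (indicator {a<..} u * h u)) = (LINT u|lborel. indicator {a..b} u * h u)"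
      proof (rule integral_cong_AE)
        show "AE u in lborel. indicator {..b} u *\<^sub>R (indicator {a<..} u * h u) = indicator {a..b} u * h u"
          using AE_lborel_singleton[of a] by eventually_elim (auto simp: indicator_def)
      qed simp_all
      then show "(LINT u|lborel. indicator {..b} u *\<^sub>R (indicator {a<..} u * h u)) = f1 b - f1 a"
        using incr[OF \<open>0 < a\<close> \<open>a \<le> b\<close>] by simp
    qed
    ultimately have "((\<lambda>b. f1 b - f1 a) \<longlongrightarrow> (LINT u|lborel. indicator {a<..} u * h u)) at_top"
      by (rule Lim_transform_eventually)
    moreover have "((\<lambda>b. f1 b - f1 a) \<longlongrightarrow> 0 - f1 a) at_top"
      by (intro tendsto_diff C0(2) tendsto_const)
    ultimately have "(LINT u|lborel. indicator {a<..} u * h u) = 0 - f1 a"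
      by (rule tendsto_unique[OF trivial_limit_at_top_linorder])
    then show ?thesis by simp
  qed
  have zero: "f1 0 = - (LINT u|lborel. indicator {0<..} u * h u)"
  proof -
    let ?s = "\<lambda>n::nat. 1 / real (Suc n)"
    have s: "?s \<longlonglongrightarrow> 0" by (rule LIMSEQ_Suc) (rule lim_1_over_n)
    have "(\<lambda>n. f1 (?s n)) \<longlonglongrightarrow> f1 0"
      by (rule continuous_on_tendsto_compose[OF C0(1) s]) simp_all
    moreover have "(\<lambda>n. - (LINT u|lborel. indicator {?s n<..} u * h u)) \<longlonglongrightarrow> - (LINT u|lborel. indicator {0<..} u * h u)"
    proof (intro tendsto_minus integral_dominated_convergence[where w="\<lambda>u. \<bar>h u\<bar>"])
      show "AE u in lborel. (\<lambda>n. indicator {?s n<..} u * h u) \<longlonglongrightarrow> indicator {0<..} u * h u"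
      proof (rule AE_I2)
        fix u :: real
        show "(\<lambda>n. indicator {?s n<..} u * h u) \<longlonglongrightarrow> indicator {0<..} u * h u"
        proof (cases "u > 0")
          case True
          then have "eventually (\<lambda>n. ?s n < u) sequentially"
            using order_tendstoD(2)[OF s] by blast
          then have "eventually (\<lambda>n. indicator {?s n<..} u * h u = indicator {0<..} u * h u) sequentially"
            by eventually_elim (use True in simp)
          then show ?thesis by (rule tendsto_eventually)
        qed (simp add: h_neg)
      qed
      show "AE u in lborel. norm (indicator {?s n<..} u * h u) \<le> \<bar>h u\<bar>" for n
        by (rule AE_I2) (simp add: indicator_def)
      show "integrable lborel (\<lambda>u. \<bar>h u\<bar>)" using int_h by simp
    qed simp_all
    moreover have "f1 (?s n) = - (LINT u|lborel. indicator {?s n<..} u * h u)" for n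
      by (rule pos) simp
    ultimately show ?thesis by (simp add: LIMSEQ_unique)
  qed
  have "f1 x = - (LINT u|lborel. indicator {\<bar>x\<bar><..} u * h u)" for x
  proof -
    have "f1 x = f1 \<bar>x\<bar>" using even[of x] by (simp add: abs_if)
    then show ?thesis using pos[of "\<bar>x\<bar>"] zero by (cases "x = 0") simp_all
  qed
  then show thesis using that[OF h _ int_h int_uh ae] h_neg by blast
qed

section \<open>Fourier transforms of superpositions\<close>

lemma superposition_Fubini:
  fixes w :: "real \<Rightarrow> real" and K :: "real \<Rightarrow> 'a::euclidean_space \<Rightarrow> 'b::euclidean_space"
  assumes w[measurable]: "w \<in> borel_measurable borel" and w0: "\<And>u. u \<le> 0 \<Longrightarrow> w u = 0"
    and K: "(\<lambda>(u,x). K u x) \<in> borel_measurable (borel \<Otimes>\<^sub>M borel)"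
    and intK: "\<And>u. u > 0 \<Longrightarrow> integrable lborel (K u)"
    and bound: "\<And>u. u > 0 \<Longrightarrow> (LINT x|lborel. norm (K u x)) \<le> m u"
    and int: "integrable lborel (\<lambda>u. m u * w u)"
  shows superposition_integrable: "integrable lborel (\<lambda>x. LINT u|lborel. w u *\<^sub>R K u x)"
    and superposition_integral: "(LINT x|lborel. LINT u|lborel. w u *\<^sub>R K u x) =
      (LINT u|lborel. w u *\<^sub>R (LINT x|lborel. K u x))"
proof -
  have meas: "(\<lambda>(u,x). w u *\<^sub>R K u x) \<in> borel_measurable (lborel \<Otimes>\<^sub>M (lborel :: 'a measure))"
    using K by (simp add: split_def measurable_cong_sets[OF sets_pair_measure_cong[OF sets_lborel sets_lborel]])
  have int2: "integrable (lborel \<Otimes>\<^sub>M lborel) (case_prod (\<lambda>u x. w u *\<^sub>R K u x))"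
  proof (rule lborel_pair.Fubini_integrable)
    show "case_prod (\<lambda>u x. w u *\<^sub>R K u x) \<in> borel_measurable (lborel \<Otimes>\<^sub>M (lborel :: 'a measure))"
      using meas by simp
    have mm: "(\<lambda>u. LINT x|lborel. norm (case_prod (\<lambda>u x. w u *\<^sub>R K u x) (u, x))) \<in> borel_measurable lborel"
      using measurable_compose[OF meas borel_measurable_norm]
      by (intro lborel.borel_measurable_lebesgue_integral) (simp add: split_def del: norm_scaleR)
    show "integrable lborel (\<lambda>u. LINT x|lborel. norm (case_prod (\<lambda>u x. w u *\<^sub>R K u x) (u, x)))"
    proof (rule Bochner_Integration.integrable_bound[OF int mm], rule AE_I2)
      fix u
      have "\<bar>w u\<bar> * (LINT x|lborel. norm (K u x)) \<le> \<bar>m u * w u\<bar>"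
      proof (cases "u > 0")
        case True
        have "(LINT x|lborel. norm (K u x)) \<le> \<bar>m u\<bar>" using bound[OF True] by linarith
        then have "\<bar>w u\<bar> * (LINT x|lborel. norm (K u x)) \<le> \<bar>w u\<bar> * \<bar>m u\<bar>" by (rule mult_left_mono) simp
        then show ?thesis by (simp add: abs_mult mult.commute)
      qed (simp add: w0)
      then show "norm (LINT x|lborel. norm (case_prod (\<lambda>u x. w u *\<^sub>R K u x) (u, x))) \<le> norm (m u * w u)"
        by simp
    qed
    show "AE u in lborel. integrable lborel (\<lambda>x. case_prod (\<lambda>u x. w u *\<^sub>R K u x) (u, x))"
    proof (rule AE_I2)
      fix u show "integrable lborel (\<lambda>x. case_prod (\<lambda>u x. w u *\<^sub>R K u x) (u, x))"
        using intK[of u] by (cases "u > 0") (auto simp: w0)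
    qed
  qed
  show "integrable lborel (\<lambda>x. LINT u|lborel. w u *\<^sub>R K u x)"
    by (rule lborel_pair.integrable_snd[OF int2])
  show "(LINT x|lborel. LINT u|lborel. w u *\<^sub>R K u x) = (LINT u|lborel. w u *\<^sub>R (LINT x|lborel. K u x))"
    using lborel_pair.Fubini_integral[OF int2] by simp
qed

text \<open>
  The Fourier transform at \<open>y\<close> of the indicator of \<open>{-u<..<u}\<close>.
\<close>

definition interval_transform :: "real \<Rightarrow> real \<Rightarrow> real" where
  "interval_transform u y = (if y = 0 then 2 * u else 2 * sin (u * y) / y)"

lemma has_bochner_integral_open_interval:
  fixes F f :: "real \<Rightarrow> 'a::euclidean_space"
  assumes "a \<le> b" and F: "\<And>x. (F has_vector_derivative f x) (at x)" and f: "continuous_on UNIV f"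
  shows "has_bochner_integral lborel (\<lambda>x. indicator {a<..<b} x *\<^sub>R f x) (F b - F a)"
proof -
  have [measurable]: "f \<in> borel_measurable borel" using f by (rule borel_measurable_continuous_onI)
  have "has_bochner_integral lborel (\<lambda>x. indicator {a..b} x *\<^sub>R f x) (F b - F a)"
    using assms by (intro has_bochner_integral_FTC_Icc)
      (auto intro: has_vector_derivative_at_within continuous_on_subset)
  moreover have "AE x in lborel. indicator {a..b} x *\<^sub>R f x = indicator {a<..<b} x *\<^sub>R f x"
    using AE_lborel_singleton[of a] AE_lborel_singleton[of b] by eventually_elim (auto simp: indicator_def)
  ultimately show ?thesis
    by (subst has_bochner_integral_cong_AE[symmetric, where f="\<lambda>x. indicator {a..b} x *\<^sub>R f x"]) simp_all
qed

lemma interval_transform_integral: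
  assumes "u > 0"
  shows "has_bochner_integral lborel (\<lambda>x. indicator {-u<..<u} x *\<^sub>R exp (- \<i> * complex_of_real (x * y)))
     (complex_of_real (interval_transform u y))"
proof (cases "y = 0")
  case True
  have "has_bochner_integral lborel (\<lambda>x. indicator {-u<..<u} x *\<^sub>R (1::complex)) (complex_of_real u - complex_of_real (-u))"
    using assms by (intro has_bochner_integral_open_interval) (auto intro!: derivative_eq_intros)
  then show ?thesis using True by (simp add: interval_transform_def)
next
  case False
  let ?F = "\<lambda>x. exp (- \<i> * complex_of_real (x * y)) / (- \<i> * complex_of_real y)"
  have "has_bochner_integral lborel (\<lambda>x. indicator {-u<..<u} x *\<^sub>R exp (- \<i> * complex_of_real (x * y))) (?F u - ?F (-u))"
  proof (rule has_bochner_integral_open_interval)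
    fix x :: real
    have ii: "- (\<i> * (z * \<i>)) = z" for z
      by (simp add: mult.commute[of z] flip: mult.assoc)
    have "((\<lambda>z. exp (- \<i> * (z * of_real y)) / (- \<i> * of_real y)) has_field_derivative exp (- \<i> * (of_real x * of_real y))) (at (of_real x))"
      using False ii by (auto intro!: derivative_eq_intros)
    from has_vector_derivative_real_field[OF this]
    show "(?F has_vector_derivative exp (- \<i> * complex_of_real (x * y))) (at x)"
      by (simp add: o_def)
  next
    show "continuous_on UNIV (\<lambda>x. exp (- \<i> * complex_of_real (x * y)))" by (intro continuous_intros)
  qed (use assms in simp)
  moreover have "?F u - ?F (-u) = complex_of_real (interval_transform u y)"
    using False by (simp add: interval_transform_def sin_of_real[symmetric] sin_exp_eq field_simps)
  ultimately show ?thesis by simp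
qed

lemma measurable_exp_minus_ii [measurable (raw)]:
  fixes \<phi> :: "'a \<Rightarrow> real"
  assumes "\<phi> \<in> borel_measurable M"
  shows "(\<lambda>x. exp (- \<i> * complex_of_real (\<phi> x))) \<in> borel_measurable M"
proof (rule measurable_compose[OF assms])
  show "(\<lambda>t. exp (- \<i> * complex_of_real t)) \<in> borel_measurable borel"
    by (intro borel_measurable_continuous_onI continuous_intros)
qed

lemma norm_exp_minus_ii [simp]: "norm (exp (- (\<i> * complex_of_real t))) = 1"
  using norm_exp_i_times[of "-t"] by simp

text \<open>
  The moment hypothesis is what Fubini's theorem needs, since the interval \<open>{-u<..<u}\<close> has length
  \<open>2 u\<close>. The exponential has modulus \<open>1\<close>, so the same application makes \<open>f\<close> integrable.
\<close>

lemma fourier_interval_superposition: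
  fixes f h :: "real \<Rightarrow> real"
  assumes h[measurable]: "h \<in> borel_measurable borel" and h0: "\<And>u. u \<le> 0 \<Longrightarrow> h u = 0"
    and int: "integrable lborel (\<lambda>u. u * h u)"
    and f: "\<And>x. f x = - (LINT u|lborel. indicator {\<bar>x\<bar><..} u * h u)"
  shows "integrable lebesgue f"
    and "fourier f y = complex_of_real (- (LINT u|lborel. h u * interval_transform u y))"
proof -
  have [measurable]: "h \<in> borel_measurable lborel" using h by simp
  have "f x = - (LINT u|lborel. (if \<bar>x\<bar> < u then h u else 0))" for x
    unfolding f by (intro arg_cong[of _ _ uminus] Bochner_Integration.integral_cong) (auto simp: indicator_def)
  then have [measurable]: "f \<in> borel_measurable borel" by (subst measurable_cong) (simp, measurable)
  define K where "K u x = indicator {-u<..<u} x *\<^sub>R exp (- \<i> * complex_of_real (x * y))" for u x :: real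
  have Kmeas: "(\<lambda>(u,x). K u x) \<in> borel_measurable (borel \<Otimes>\<^sub>M borel)"
  proof -
    have "(\<lambda>(u,x). K u x) =
        (\<lambda>p. if - fst p < snd p \<and> snd p < fst p then exp (- \<i> * complex_of_real (snd p * y)) else 0)"
      by (auto simp: K_def indicator_def fun_eq_iff)
    then show ?thesis by simp
  qed
  have Kint: "integrable lborel (K u)" "(LINT x|lborel. K u x) = of_real (interval_transform u y)" if "u > 0" for u
    using interval_transform_integral[OF that, of y] unfolding K_def[abs_def]
    by (auto simp: has_bochner_integral_iff)
  have nK: "(LINT x|lborel. norm (K u x)) \<le> 2 * u" if "u > 0" for u
    using that by (simp add: K_def)
  have int2: "integrable lborel (\<lambda>u. 2 * u * h u)" using int by (simp add: mult.assoc)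
  note F = superposition_Fubini[OF h h0 Kmeas Kint(1) nK int2]
  have point: "h u *\<^sub>R (LINT x|lborel. K u x) = complex_of_real (h u * interval_transform u y)" for u
    by (cases "u > 0") (simp_all add: Kint(2) h0 scaleR_conv_of_real)
  have fK: "(LINT u|lborel. h u *\<^sub>R K u x) = - (complex_of_real (f x) * exp (- \<i> * complex_of_real (x * y)))" for x
  proof -
    have "(LINT u|lborel. h u *\<^sub>R K u x) = (LINT u|lborel. complex_of_real (indicator {\<bar>x\<bar><..} u * h u) * exp (- \<i> * complex_of_real (x * y)))"
      by (rule Bochner_Integration.integral_cong) (auto simp: K_def scaleR_conv_of_real indicator_def)
    also have "\<dots> = (LINT u|lborel. complex_of_real (indicator {\<bar>x\<bar><..} u * h u)) * exp (- \<i> * complex_of_real (x * y))"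
      by (rule integral_mult_left_zero)
    also have "(LINT u|lborel. complex_of_real (indicator {\<bar>x\<bar><..} u * h u)) = of_real (- f x)"
      unfolding f integral_complex_of_real by simp
    finally show ?thesis by simp
  qed
  have "integrable lborel (\<lambda>x. - (complex_of_real (f x) * exp (- \<i> * complex_of_real (x * y))))"
    using F(1) unfolding fK .
  then have "integrable lborel (\<lambda>x. norm (- (complex_of_real (f x) * exp (- \<i> * complex_of_real (x * y)))))"
    by (rule integrable_norm)
  then have "integrable lborel f"
    by (simp add: norm_mult integrable_abs_iff)
  then show "integrable lebesgue f" by (simp add: integrable_completion)
  have "fourier f y = (LINT x|lborel. complex_of_real (f x) * exp (- \<i> * complex_of_real (x * y)))"
    unfolding fourier_def inner_real_def by (rule integral_completion) measurable
  also have "\<dots> = - (LINT x|lborel. LINT u|lborel. h u *\<^sub>R K u x)"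
    unfolding fK by simp
  also have "\<dots> = - (LINT u|lborel. complex_of_real (h u * interval_transform u y))"
    by (simp only: F(2) point)
  finally show "fourier f y = complex_of_real (- (LINT u|lborel. h u * interval_transform u y))"
    by (simp add: integral_complex_of_real del: of_real_mult)
qed

lemma square_transform_integral:
  assumes "u > 0"
  shows "has_bochner_integral lborel (\<lambda>x::real \<times> real. indicator ({-u<..<u} \<times> {-u<..<u}) x *\<^sub>R exp (- \<i> * complex_of_real (x \<bullet> y)))
     (complex_of_real (interval_transform u (fst y) * interval_transform u (snd y)))"
proof -
  let ?e = "\<lambda>z x. indicator {-u<..<u} x *\<^sub>R exp (- \<i> * complex_of_real (x * z))"
  have e: "integrable lborel (?e z)" "(LINT x|lborel. ?e z x) = complex_of_real (interval_transform u z)" for z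
    using interval_transform_integral[OF assms, of z] by (auto simp: has_bochner_integral_iff)
  have split: "indicator ({-u<..<u} \<times> {-u<..<u}) x *\<^sub>R exp (- \<i> * complex_of_real (x \<bullet> y)) =
      ?e (fst y) (fst x) * ?e (snd y) (snd x)" for x :: "real \<times> real"
  proof -
    have "exp (- \<i> * complex_of_real (x \<bullet> y)) = exp (- \<i> * complex_of_real (fst x * fst y)) * exp (- \<i> * complex_of_real (snd x * snd y))"
      unfolding exp_add[symmetric] by (simp add: inner_prod_def algebra_simps)
    then show ?thesis by (cases x) (auto simp: indicator_def)
  qed
  have int: "integrable (lborel \<Otimes>\<^sub>M lborel) (\<lambda>x. ?e (fst y) (fst x) * ?e (snd y) (snd x))"
  proof (rule lborel_pair.Fubini_integrable)
    show "(\<lambda>x. ?e (fst y) (fst x) * ?e (snd y) (snd x)) \<in> borel_measurable (lborel \<Otimes>\<^sub>M lborel)"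
      by measurable
    have "(LINT b|lborel. norm (?e (fst y) a * ?e (snd y) b)) = norm (?e (fst y) a) * (LINT b|lborel. norm (?e (snd y) b))" for a
      by (simp only: norm_mult integral_mult_right_zero)
    then show "integrable lborel (\<lambda>a. LINT b|lborel. norm (?e (fst y) (fst (a, b)) * ?e (snd y) (snd (a, b))))"
      using integrable_mult_left[OF integrable_norm[OF e(1)]] by (simp only: fst_conv snd_conv)
    show "AE a in lborel. integrable lborel (\<lambda>b. ?e (fst y) (fst (a, b)) * ?e (snd y) (snd (a, b)))"
      using e(1)[of "snd y"] by (intro AE_I2) (simp only: fst_conv snd_conv integrable_mult_right)
  qed
  show ?thesis
    unfolding split has_bochner_integral_iff
  proof
    show "integrable lborel (\<lambda>x. ?e (fst y) (fst x) * ?e (snd y) (snd x))"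
      using int by (simp only: lborel_prod)
    have "(LINT x|lborel. ?e (fst y) (fst x) * ?e (snd y) (snd x)) =
        (LINT a|lborel. LINT b|lborel. ?e (fst y) a * ?e (snd y) b)"
      using lborel_pair.integral_fst'[OF int] by (simp only: lborel_prod fst_conv snd_conv)
    also have "\<dots> = (LINT a|lborel. ?e (fst y) a * of_real (interval_transform u (snd y)))"
      by (simp only: integral_mult_right_zero e(2))
    also have "\<dots> = of_real (interval_transform u (fst y)) * of_real (interval_transform u (snd y))"
      by (simp only: integral_mult_left_zero e(2))
    finally show "(LINT x|lborel. ?e (fst y) (fst x) * ?e (snd y) (snd x)) =
        complex_of_real (interval_transform u (fst y) * interval_transform u (snd y))"
      by simp
  qed
qed

text \<open>
  The origin is excepted from the representation of \<open>f\<close>: there the integral of \<open>k\<close> over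
  \<open>{0<..}\<close> may diverge, and a single point does not affect the transform.
\<close>

lemma fourier_square_superposition:
  fixes f :: "real \<times> real \<Rightarrow> real" and k :: "real \<Rightarrow> real"
  assumes k[measurable]: "k \<in> borel_measurable borel" and k0: "\<And>u. u \<le> 0 \<Longrightarrow> k u = 0"
    and int: "integrable lborel (\<lambda>u. u\<^sup>2 * k u)"
    and f: "\<And>x1 x2. (x1, x2) \<noteq> 0 \<Longrightarrow> f (x1, x2) = - (LINT u|lborel. indicator {max \<bar>x1\<bar> \<bar>x2\<bar><..} u * k u)"
  shows "integrable lebesgue f"
    and "fourier f y = complex_of_real (- (LINT u|lborel. k u * (interval_transform u (fst y) * interval_transform u (snd y))))"
proof -
  have [measurable]: "k \<in> borel_measurable lborel" using k by simp
  define f' where "f' x = - (LINT u|lborel. (if max \<bar>fst x\<bar> \<bar>snd x\<bar> < u then k u else 0))" for x :: "real \<times> real"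
  have [measurable]: "f' \<in> borel_measurable borel"
    unfolding f'_def[abs_def] borel_prod[symmetric] by measurable
  have ff': "f x = f' x" if "x \<noteq> 0" for x
  proof -
    have "f x = - (LINT u|lborel. indicator {max \<bar>fst x\<bar> \<bar>snd x\<bar><..} u * k u)"
      using f[of "fst x" "snd x"] that by simp
    also have "\<dots> = f' x"
      unfolding f'_def by (intro arg_cong[of _ _ uminus] Bochner_Integration.integral_cong) (auto simp: indicator_def)
    finally show ?thesis .
  qed
  have ae: "AE x in lebesgue. f x = f' x"
    using AE_completion[OF AE_lborel_singleton[of "0 :: real \<times> real"]] by eventually_elim (rule ff')
  define K where "K u x = indicator ({-u<..<u} \<times> {-u<..<u}) x *\<^sub>R exp (- \<i> * complex_of_real (x \<bullet> y))"
    for u and x :: "real \<times> real"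
  have Kmeas: "(\<lambda>(u,x). K u x) \<in> borel_measurable (borel \<Otimes>\<^sub>M borel)"
  proof -
    have "(\<lambda>(u,x). K u x) =
        (\<lambda>p. if - fst p < fst (snd p) \<and> fst (snd p) < fst p \<and> - fst p < snd (snd p) \<and> snd (snd p) < fst p
             then exp (- \<i> * complex_of_real (snd p \<bullet> y)) else 0)"
      by (auto simp: K_def indicator_def fun_eq_iff)
    also have "\<dots> \<in> borel_measurable (borel \<Otimes>\<^sub>M borel)"
      unfolding inner_prod_def borel_prod[symmetric] by measurable
    finally show ?thesis .
  qed
  have Kint: "integrable lborel (K u)"
    "(LINT x|lborel. K u x) = of_real (interval_transform u (fst y) * interval_transform u (snd y))" if "u > 0" for u
    using square_transform_integral[OF that, of y] unfolding K_def[abs_def]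
    by (auto simp: has_bochner_integral_iff)
  have nK: "(LINT x|lborel. norm (K u x)) \<le> 4 * u\<^sup>2" if "u > 0" for u
  proof -
    have "(LINT x|lborel. norm (K u x)) = measure lborel ({-u<..<u} \<times> {-u<..<u})"
      by (simp add: K_def)
    also have "\<dots> = 4 * u\<^sup>2"
    proof -
      have "complex_of_real (measure lborel ({-u<..<u} \<times> {-u<..<u})) = complex_of_real (4 * u\<^sup>2)"
        using square_transform_integral[OF that, of 0]
        by (simp add: has_bochner_integral_iff interval_transform_def power2_eq_square scaleR_conv_of_real)
      then show ?thesis by (simp only: of_real_eq_iff)
    qed
    finally show ?thesis by simp
  qed
  have int2: "integrable lborel (\<lambda>u. 4 * u\<^sup>2 * k u)" using int by (simp add: mult.assoc)
  note F = superposition_Fubini[OF k k0 Kmeas Kint(1) nK int2]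
  have point: "k u *\<^sub>R (LINT x|lborel. K u x) =
      complex_of_real (k u * (interval_transform u (fst y) * interval_transform u (snd y)))" for u
    by (cases "u > 0") (simp_all add: Kint(2) k0 scaleR_conv_of_real)
  have fK: "(LINT u|lborel. k u *\<^sub>R K u x) = - (complex_of_real (f' x) * exp (- \<i> * complex_of_real (x \<bullet> y)))" for x
  proof -
    have "(LINT u|lborel. k u *\<^sub>R K u x) =
        (LINT u|lborel. complex_of_real (if max \<bar>fst x\<bar> \<bar>snd x\<bar> < u then k u else 0) * exp (- \<i> * complex_of_real (x \<bullet> y)))"
      by (rule Bochner_Integration.integral_cong) (auto simp: K_def scaleR_conv_of_real indicator_def mem_Times_iff)
    also have "\<dots> = (LINT u|lborel. complex_of_real (if max \<bar>fst x\<bar> \<bar>snd x\<bar> < u then k u else 0)) * exp (- \<i> * complex_of_real (x \<bullet> y))"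
      by (rule integral_mult_left_zero)
    also have "(LINT u|lborel. complex_of_real (if max \<bar>fst x\<bar> \<bar>snd x\<bar> < u then k u else 0)) = of_real (- f' x)"
      unfolding f'_def integral_complex_of_real by simp
    finally show ?thesis by simp
  qed
  have "integrable lborel (\<lambda>x. - (complex_of_real (f' x) * exp (- \<i> * complex_of_real (x \<bullet> y))))"
    using F(1) unfolding fK .
  then have "integrable lborel (\<lambda>x. norm (- (complex_of_real (f' x) * exp (- \<i> * complex_of_real (x \<bullet> y)))))"
    by (rule integrable_norm)
  then have "integrable lborel f'"
    by (simp add: norm_mult integrable_abs_iff)
  then show "integrable lebesgue f" using integrable_cong_borel[OF ae] by simp
  have "fourier f y = (LINT x|lborel. complex_of_real (f' x) * exp (- \<i> * complex_of_real (x \<bullet> y)))"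
    unfolding fourier_def
  proof (rule integral_cong_borel)
    show "AE x in lebesgue. complex_of_real (f x) * exp (- \<i> * complex_of_real (x \<bullet> y)) =
        complex_of_real (f' x) * exp (- \<i> * complex_of_real (x \<bullet> y))"
      using ae by eventually_elim simp
  qed measurable
  also have "\<dots> = - (LINT x|lborel. LINT u|lborel. k u *\<^sub>R K u x)"
    unfolding fK by simp
  also have "\<dots> = - (LINT u|lborel. complex_of_real (k u * (interval_transform u (fst y) * interval_transform u (snd y))))"
    by (simp only: F(2) point)
  finally show "fourier f y = complex_of_real (- (LINT u|lborel. k u * (interval_transform u (fst y) * interval_transform u (snd y))))"
    by (simp add: integral_complex_of_real del: of_real_mult)
qed

section \<open>The transform on the plane as an average of the transform on the line\<close>

lemma interval_transform_simps [simp]: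
  "interval_transform u 0 = 2 * u"
  "interval_transform u (- y) = interval_transform u y"
  by (simp_all add: interval_transform_def)

lemma interval_transform_abs: "interval_transform u \<bar>y\<bar> = interval_transform u y"
  by (simp add: abs_if)

lemma times_interval_transform: "y * interval_transform u y = 2 * sin (u * y)"
  by (simp add: interval_transform_def)

text \<open>
  Integrating \<open>2 sin (u s)\<close> over \<open>y1 - y2 < s < y1 + y2\<close> gives
  \<open>2 (cos (u (y1 - y2)) - cos (u (y1 + y2))) / u = 4 sin (u y1) sin (u y2) / u\<close>, that is
  \<open>y1 y2 / u\<close> times the product of the two interval transforms. Exchanging this integral with
  the one over \<open>u\<close> yields the formula.
\<close>

lemma square_transform_eq_average:
  fixes h :: "real \<Rightarrow> real"
  assumes h[measurable]: "h \<in> borel_measurable borel" and h0: "\<And>u. u \<le> 0 \<Longrightarrow> h u = 0"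
    and int: "integrable lborel h" and "0 \<le> y2"
  defines "\<Phi> \<equiv> \<lambda>s. - (LINT u|lborel. h u * interval_transform u s)"
  shows "integrable lborel (\<lambda>s. indicator {y1 - y2<..<y1 + y2} s * (s * \<Phi> s))"
    and "(LINT s|lborel. indicator {y1 - y2<..<y1 + y2} s * (s * \<Phi> s)) =
      y1 * y2 * - (LINT u|lborel. h u / u * (interval_transform u y1 * interval_transform u y2))"
proof -
  define K :: "real \<Rightarrow> real \<Rightarrow> real" where "K u s = indicator {y1 - y2<..<y1 + y2} s *\<^sub>R (2 * sin (u * s))" for u s
  have Kmeas: "(\<lambda>(u,s). K u s) \<in> borel_measurable (borel \<Otimes>\<^sub>M borel)"
  proof -
    have "(\<lambda>(u,s). K u s) = (\<lambda>p. if y1 - y2 < snd p \<and> snd p < y1 + y2 then 2 * sin (fst p * snd p) else 0)"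
      by (auto simp: K_def indicator_def fun_eq_iff)
    then show ?thesis by simp
  qed
  have K: "has_bochner_integral lborel (K u) (1 / u * (y1 * interval_transform u y1 * (y2 * interval_transform u y2)))"
    if "u > 0" for u
  proof -
    have "has_bochner_integral lborel (\<lambda>s. indicator {y1 - y2<..<y1 + y2} s *\<^sub>R (2 * sin (u * s)))
       (- 2 * cos (u * (y1 + y2)) / u - (- 2 * cos (u * (y1 - y2)) / u))"
    proof (rule has_bochner_integral_open_interval)
      fix s show "((\<lambda>s. - 2 * cos (u * s) / u) has_vector_derivative 2 * sin (u * s)) (at s)"
        unfolding has_real_derivative_iff_has_vector_derivative[symmetric]
        using that by (auto intro!: derivative_eq_intros)
    next
      show "continuous_on UNIV (\<lambda>s. 2 * sin (u * s))" by (intro continuous_intros)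
    qed (use \<open>0 \<le> y2\<close> in simp)
    moreover have "- 2 * cos (u * (y1 + y2)) / u - (- 2 * cos (u * (y1 - y2)) / u) =
        1 / u * (y1 * interval_transform u y1 * (y2 * interval_transform u y2))"
      unfolding times_interval_transform using that
      by (simp add: distrib_left right_diff_distrib cos_add cos_diff field_simps)
    ultimately show ?thesis by (simp add: K_def[abs_def])
  qed
  have nK: "(LINT s|lborel. norm (K u s)) \<le> 4 * y2" if "u > 0" for u
  proof -
    have "(LINT s|lborel. norm (K u s)) \<le> (LINT s|lborel. indicator {y1 - y2<..<y1 + y2} s * 2)"
    proof (rule integral_mono)
      show "integrable lborel (\<lambda>s. norm (K u s))"
        using K[OF that] by (auto simp: has_bochner_integral_iff)
      show "integrable lborel (\<lambda>s. indicator {y1 - y2<..<y1 + y2} s * 2 :: real)"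
        using \<open>0 \<le> y2\<close> by (intro integrable_mult_left integrable_real_indicator) simp_all
      show "norm (K u s) \<le> indicator {y1 - y2<..<y1 + y2} s * 2" for s
        by (simp add: K_def abs_mult indicator_def)
    qed
    also have "\<dots> = 4 * y2" using \<open>0 \<le> y2\<close> by simp
    finally show ?thesis .
  qed
  have int2: "integrable lborel (\<lambda>u. 4 * y2 * h u)" using int by simp
  have Kint: "integrable lborel (K u)" if "u > 0" for u
    using K[OF that] by (simp add: has_bochner_integral_iff)
  note F = superposition_Fubini[OF h h0 Kmeas Kint nK int2]
  have hK: "(LINT u|lborel. h u *\<^sub>R K u s) = - (indicator {y1 - y2<..<y1 + y2} s * (s * \<Phi> s))" for s
  proof -
    have "(LINT u|lborel. h u *\<^sub>R K u s) =
        (LINT u|lborel. indicator {y1 - y2<..<y1 + y2} s * s * (h u * interval_transform u s))"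
    proof (rule Bochner_Integration.integral_cong[OF refl])
      fix u
      show "h u *\<^sub>R K u s = indicator {y1 - y2<..<y1 + y2} s * s * (h u * interval_transform u s)"
        unfolding K_def times_interval_transform[symmetric] by simp
    qed
    also have "\<dots> = - (indicator {y1 - y2<..<y1 + y2} s * (s * \<Phi> s))"
      by (simp add: \<Phi>_def)
    finally show ?thesis .
  qed
  show "integrable lborel (\<lambda>s. indicator {y1 - y2<..<y1 + y2} s * (s * \<Phi> s))"
    using F(1) unfolding hK by simp
  have "- (LINT s|lborel. indicator {y1 - y2<..<y1 + y2} s * (s * \<Phi> s)) = (LINT u|lborel. h u *\<^sub>R (LINT s|lborel. K u s))"
    using F(2) unfolding hK by simp
  also have "\<dots> = (LINT u|lborel. y1 * y2 * (h u / u * (interval_transform u y1 * interval_transform u y2)))"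
  proof (rule Bochner_Integration.integral_cong[OF refl])
    fix u
    show "h u *\<^sub>R (LINT s|lborel. K u s) = y1 * y2 * (h u / u * (interval_transform u y1 * interval_transform u y2))"
    proof (cases "u > 0")
      case True
      have "(LINT s|lborel. K u s) = 1 / u * (y1 * interval_transform u y1 * (y2 * interval_transform u y2))"
        by (rule has_bochner_integral_integral_eq[OF K[OF True]])
      then show ?thesis by simp
    qed (simp add: h0)
  qed
  also have "\<dots> = y1 * y2 * (LINT u|lborel. h u / u * (interval_transform u y1 * interval_transform u y2))"
    by (rule integral_mult_right_zero)
  finally show "(LINT s|lborel. indicator {y1 - y2<..<y1 + y2} s * (s * \<Phi> s)) =
      y1 * y2 * - (LINT u|lborel. h u / u * (interval_transform u y1 * interval_transform u y2))"
    by (simp only: mult_minus_right)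
qed

text \<open>
  Everything is even and symmetric in \<open>(y1, y2)\<close>, so the average may be taken for
  \<open>0 \<le> b \<le> a\<close>, where it runs over nonnegative \<open>s\<close> only. For \<open>b = 0\<close> the average degenerates
  and is replaced by the identity on the axis.
\<close>

lemma square_transform_positivity:
  fixes h :: "real \<Rightarrow> real"
  assumes h: "h \<in> borel_measurable borel" and h0: "\<And>u. u \<le> 0 \<Longrightarrow> h u = 0"
    and int: "integrable lborel h"
  defines "\<Phi> \<equiv> \<lambda>s. - (LINT u|lborel. h u * interval_transform u s)"
    and "\<Psi> \<equiv> \<lambda>y1 y2. - (LINT u|lborel. h u / u * (interval_transform u y1 * interval_transform u y2))"
  shows square_transform_axis: "\<Psi> y1 0 = 2 * \<Phi> y1"
    and square_transform_nonneg: "(\<And>s. 0 \<le> \<Phi> s) \<Longrightarrow> 0 \<le> \<Psi> y1 y2"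
    and square_transform_pos: "(\<And>s. 0 < \<Phi> s) \<Longrightarrow> 0 < \<Psi> y1 y2"
proof -
  show axis: "\<Psi> y1 0 = 2 * \<Phi> y1" for y1
  proof -
    have "(LINT u|lborel. h u / u * (interval_transform u y1 * interval_transform u 0)) =
        (LINT u|lborel. 2 * (h u * interval_transform u y1))"
    proof (rule Bochner_Integration.integral_cong[OF refl])
      fix u show "h u / u * (interval_transform u y1 * interval_transform u 0) = 2 * (h u * interval_transform u y1)"
        by (cases "u > 0") (simp_all add: h0)
    qed
    then show ?thesis by (simp add: \<Psi>_def \<Phi>_def)
  qed
  define a where "a = max \<bar>y1\<bar> \<bar>y2\<bar>"
  define b where "b = min \<bar>y1\<bar> \<bar>y2\<bar>"
  have ab: "0 \<le> b" "b \<le> a" by (auto simp: a_def b_def)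
  have sym: "\<Psi> y1 y2 = \<Psi> a b"
  proof -
    have "\<Psi> y1 y2 = \<Psi> \<bar>y1\<bar> \<bar>y2\<bar>" by (simp add: \<Psi>_def interval_transform_abs)
    also have "\<dots> = \<Psi> a b"
      by (cases "\<bar>y1\<bar> \<le> \<bar>y2\<bar>") (simp_all add: a_def b_def \<Psi>_def mult.commute)
    finally show ?thesis .
  qed
  have avg: "integrable lborel (\<lambda>s. indicator {a - b<..<a + b} s * (s * \<Phi> s))"
    "(LINT s|lborel. indicator {a - b<..<a + b} s * (s * \<Phi> s)) = a * b * \<Psi> a b"
    using square_transform_eq_average[OF h h0 int ab(1), of a] unfolding \<Phi>_def \<Psi>_def by blast+
  have nonneg: "0 \<le> indicator {a - b<..<a + b} s * (s * \<Phi> s)" if "\<And>s. 0 \<le> \<Phi> s" for s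
  proof -
    have "0 \<le> s" if "s \<in> {a - b<..<a + b}" using that ab by simp
    then show ?thesis using \<open>\<And>s. 0 \<le> \<Phi> s\<close> by (simp add: indicator_def)
  qed
  show "0 \<le> \<Psi> y1 y2" if \<Phi>: "\<And>s. 0 \<le> \<Phi> s"
  proof (cases "b = 0")
    case True
    then show ?thesis unfolding sym using axis[of a] \<Phi> by simp
  next
    case False
    then have "0 < a * b" using ab by simp
    moreover have "0 \<le> a * b * \<Psi> a b"
      unfolding avg(2)[symmetric] using nonneg[OF \<Phi>] by (rule Bochner_Integration.integral_nonneg)
    ultimately show ?thesis unfolding sym by (simp add: zero_le_mult_iff)
  qed
  show "0 < \<Psi> y1 y2" if \<Phi>: "\<And>s. 0 < \<Phi> s"
  proof (cases "b = 0")
    case True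
    then show ?thesis unfolding sym using axis[of a] \<Phi> by simp
  next
    case False
    then have "0 < a * b" "0 < b" using ab by simp_all
    have \<Phi>': "0 \<le> \<Phi> s" for s using \<Phi>[of s] by simp
    have "(LINT s|lborel. indicator {a - b<..<a + b} s * (s * \<Phi> s)) \<noteq> 0"
    proof
      assume "(LINT s|lborel. indicator {a - b<..<a + b} s * (s * \<Phi> s)) = 0"
      then have "AE s in lborel. indicator {a - b<..<a + b} s * (s * \<Phi> s) = 0"
        using integral_nonneg_eq_0_iff_AE[OF avg(1)] nonneg[OF \<Phi>'] by simp
      then have "AE s in lborel. s \<notin> {a - b<..<a + b}"
      proof eventually_elim
        case (elim s)
        show ?case
        proof
          assume s: "s \<in> {a - b<..<a + b}"
          then have "0 < s" using ab by simp
          with elim s \<Phi>[of s] show False by simp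
        qed
      qed
      then have "{a - b<..<a + b} \<in> null_sets lborel" by (subst AE_iff_null_sets) simp_all
      then have "emeasure lborel {a - b<..<a + b} = 0" by (simp add: null_sets_def)
      then show False using \<open>0 < b\<close> by simp
    qed
    moreover have "0 \<le> a * b * \<Psi> a b"
      unfolding avg(2)[symmetric] using nonneg[OF \<Phi>'] by (rule Bochner_Integration.integral_nonneg)
    ultimately have "0 < a * b * \<Psi> a b" unfolding avg(2) by (metis less_le)
    then show ?thesis unfolding sym using \<open>0 < a * b\<close> by (simp add: zero_less_mult_iff)
  qed
qed

section \<open>The profile of the function on the plane\<close>

text \<open>
  Exchanging integrals, \<open>- (h u / u)\<close> is integrated over \<open>a < t < u\<close>, which contributes the factor
  \<open>u - a\<close> and hence \<open>- h u + a h u / u\<close>; the two terms integrate to \<open>f1 a\<close> and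
  \<open>- a f0 a\<close>.
\<close>

lemma tail_average:
  fixes h f0 f1 :: "real \<Rightarrow> real"
  assumes h[measurable]: "h \<in> borel_measurable borel" and h0: "\<And>u. u \<le> 0 \<Longrightarrow> h u = 0"
    and int: "integrable lborel h" and "0 \<le> a"
    and f1: "\<And>x. 0 \<le> x \<Longrightarrow> f1 x = - (LINT u|lborel. indicator {x<..} u * h u)"
    and f0: "\<And>t. 0 < t \<Longrightarrow> f0 t = - (LINT u|lborel. indicator {t<..} u * (h u / u))"
  shows "integrable lborel (\<lambda>t. indicator {a<..} t * f0 t)"
    and "f1 a = a * f0 a + (LINT t|lborel. indicator {a<..} t * f0 t)"
proof -
  define K :: "real \<Rightarrow> real \<Rightarrow> real" where "K u t = indicator {a<..<u} t" for u t
  have Kmeas: "(\<lambda>(u,t). K u t) \<in> borel_measurable (borel \<Otimes>\<^sub>M borel)"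
  proof -
    have "(\<lambda>(u,t). K u t) = (\<lambda>p. if a < snd p \<and> snd p < fst p then 1 else 0)"
      by (auto simp: K_def indicator_def fun_eq_iff)
    then show ?thesis by simp
  qed
  have Kval: "integrable lborel (K u)" "(LINT t|lborel. K u t) = max (u - a) 0" for u
    by (cases "a \<le> u"; simp add: K_def[abs_def])+
  have nK: "(LINT t|lborel. norm (K u t)) \<le> u" if "u > 0" for u
  proof -
    have "(LINT t|lborel. norm (K u t)) = (LINT t|lborel. K u t)" by (simp add: K_def)
    also have "\<dots> \<le> u" unfolding Kval using \<open>0 \<le> a\<close> that by simp
    finally show ?thesis .
  qed
  have k[measurable]: "(\<lambda>u. h u / u) \<in> borel_measurable borel" by measurable
  have k0: "h u / u = 0" if "u \<le> 0" for u using h0[OF that] by simp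
  have uk: "u * (h u / u) = h u" for u by (cases "u = 0") (simp_all add: h0)
  have int2: "integrable lborel (\<lambda>u. u * (h u / u))" unfolding uk by (rule int)
  note F = superposition_Fubini[OF k k0 Kmeas Kval(1) nK int2]
  have kK: "(LINT u|lborel. (h u / u) *\<^sub>R K u t) = - (indicator {a<..} t * f0 t)" for t
  proof (cases "a < t")
    case True
    then have "(LINT u|lborel. (h u / u) *\<^sub>R K u t) = (LINT u|lborel. indicator {t<..} u * (h u / u))"
      by (intro Bochner_Integration.integral_cong) (auto simp: K_def indicator_def)
    then show ?thesis using True \<open>0 \<le> a\<close> f0[of t] by simp
  next
    case False
    then have "K u t = 0" for u by (simp add: K_def)
    then show ?thesis using False by simp
  qed
  show "integrable lborel (\<lambda>t. indicator {a<..} t * f0 t)"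
    using F(1) unfolding kK by simp
  have "- (LINT t|lborel. indicator {a<..} t * f0 t) = (LINT u|lborel. (h u / u) *\<^sub>R max (u - a) 0)"
    using F(2) unfolding kK Kval by simp
  also have "\<dots> = (LINT u|lborel. indicator {a<..} u * h u - a * (indicator {a<..} u * (h u / u)))"
  proof (rule Bochner_Integration.integral_cong[OF refl])
    fix u
    show "(h u / u) *\<^sub>R max (u - a) 0 = indicator {a<..} u * h u - a * (indicator {a<..} u * (h u / u))"
    proof (cases "a < u")
      case True
      then have "u \<noteq> 0" using \<open>0 \<le> a\<close> by simp
      then show ?thesis using True by (simp add: field_simps)
    qed simp
  qed
  also have "\<dots> = (LINT u|lborel. indicator {a<..} u * h u) - (LINT u|lborel. a * (indicator {a<..} u * (h u / u)))"
  proof (rule Bochner_Integration.integral_diff)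
    show "integrable lborel (\<lambda>u. indicator {a<..} u * h u)"
      using integrable_mult_indicator[OF _ int, of "{a<..}"] by simp
    show "integrable lborel (\<lambda>u. a * (indicator {a<..} u * (h u / u)))"
    proof (rule Bochner_Integration.integrable_bound[OF int], measurable, rule AE_I2)
      fix u
      have "a * (\<bar>h u\<bar> / u) \<le> \<bar>h u\<bar>" if "a < u"
        using that \<open>0 \<le> a\<close> mult_right_mono[of a u "\<bar>h u\<bar>"] by (simp add: field_simps)
      then show "norm (a * (indicator {a<..} u * (h u / u))) \<le> norm (h u)"
        using \<open>0 \<le> a\<close> by (auto simp: indicator_def abs_mult)
    qed
  qed
  also have "\<dots> = - f1 a + a * f0 a"
  proof -
    have "(LINT u|lborel. a * (indicator {a<..} u * (h u / u))) = a * (LINT u|lborel. indicator {a<..} u * (h u / u))"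
      by (rule integral_mult_right_zero)
    moreover have "a * (LINT u|lborel. indicator {a<..} u * (h u / u)) = - (a * f0 a)"
      using f0[of a] \<open>0 \<le> a\<close> by (cases "a = 0") simp_all
    ultimately show ?thesis using f1[OF \<open>0 \<le> a\<close>] by linarith
  qed
  finally show "f1 a = a * f0 a + (LINT t|lborel. indicator {a<..} t * f0 t)" by simp
qed

text \<open>
  Solving the relation for \<open>f0\<close> shows first that \<open>f0\<close> is continuous, then that the tail
  integral has derivative \<open>- f0 t\<close> at every \<open>t > 0\<close>, and finally that \<open>f0\<close> is differentiable
  wherever \<open>f1\<close> is. This avoids Lebesgue's differentiation theorem for the integral that
  defines \<open>f0\<close>.
\<close>

lemma tail_average_derivative:
  fixes f0 f1 :: "real \<Rightarrow> real"
  assumes rep: "\<And>t. 0 < t \<Longrightarrow> f1 t = t * f0 t + (LINT s|lborel. indicator {t<..} s * f0 s)"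
    and int: "integrable lborel (\<lambda>t. indicator {0<..} t * f0 t)"
    and cont: "continuous_on {0..} f1"
    and "0 < t" and der: "(f1 has_real_derivative D) (at t)"
  shows "(f0 has_real_derivative D / t) (at t)"
proof -
  define a where "a = t / 2"
  define b where "b = 2 * t"
  have ab: "0 < a" "a < t" "t < b" using \<open>0 < t\<close> by (simp_all add: a_def b_def)
  define G where "G s = (LINT r|lborel. indicator {s<..} r * f0 r)" for s
  have G_int: "integrable lborel (\<lambda>r. indicator {s<..} r * f0 r)" if "0 < s" for s
  proof -
    have "(\<lambda>r. indicator {s<..} r *\<^sub>R (indicator {0<..} r * f0 r)) = (\<lambda>r. indicator {s<..} r * f0 r)"
      using that by (auto simp: indicator_def fun_eq_iff)
    then show ?thesis using integrable_mult_indicator[OF _ int, of "{s<..}"] by simp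
  qed
  have si: "set_integrable lborel {a..s} f0" for s
  proof -
    have "(\<lambda>r. indicator {a..s} r *\<^sub>R (indicator {0<..} r * f0 r)) = (\<lambda>r. indicator {a..s} r *\<^sub>R f0 r)"
      using ab by (auto simp: indicator_def fun_eq_iff)
    then show ?thesis unfolding set_integrable_def
      using integrable_mult_indicator[OF _ int, of "{a..s}"] by simp
  qed
  have hk: "f0 integrable_on {a..s}" "(LINT r:{a..s}|lborel. f0 r) = integral {a..s} f0" for s
    using set_borel_integral_eq_integral[OF si] by simp_all
  have G: "G s = G a - integral {a..s} f0" if "a \<le> s" for s
  proof -
    have "G a = (LINT r|lborel. indicator {a..s} r *\<^sub>R f0 r + indicator {s<..} r * f0 r)"
      unfolding G_def
    proof (rule integral_cong_AE)
      show "(\<lambda>r. indicator {a<..} r * f0 r) \<in> borel_measurable lborel"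
        using G_int[of a] ab by simp
      show "(\<lambda>r. indicator {a..s} r *\<^sub>R f0 r + indicator {s<..} r * f0 r) \<in> borel_measurable lborel"
        using G_int[of s] si[of s] ab that unfolding set_integrable_def
        by (intro borel_measurable_add borel_measurable_integrable) auto
      show "AE r in lborel. indicator {a<..} r * f0 r = indicator {a..s} r *\<^sub>R f0 r + indicator {s<..} r * f0 r"
        using AE_lborel_singleton[of a] by eventually_elim (use that in \<open>auto simp: indicator_def\<close>)
    qed
    also have "\<dots> = (LINT r:{a..s}|lborel. f0 r) + G s"
      unfolding G_def set_lebesgue_integral_def
      using G_int[of s] si[of s] ab that unfolding set_integrable_def
      by (intro Bochner_Integration.integral_add) auto
    finally show ?thesis by (simp add: hk(2))
  qed
  have cG: "continuous_on {a..b} G"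
  proof -
    have "continuous_on {a..b} (\<lambda>s. G a - integral {a..s} f0)"
      by (intro continuous_intros indefinite_integral_continuous_1 hk(1))
    then show ?thesis by (rule continuous_on_eq) (rule G[symmetric], simp)
  qed
  have f0_eq: "f0 s = (f1 s - G s) / s" if "0 < s" for s
    using rep[OF that] that by (simp add: G_def)
  have "continuous_on {a..b} (\<lambda>s. (f1 s - G s) / s)"
    using ab by (intro continuous_on_divide continuous_on_diff cG continuous_on_subset[OF cont] continuous_on_id) auto
  then have cf0: "continuous_on {a..b} f0"
    by (rule continuous_on_eq) (use ab f0_eq in auto)
  have "((\<lambda>s. integral {a..s} f0) has_real_derivative f0 t) (at t within {a..b})"
    by (rule integral_has_real_derivative[OF cf0]) (use ab in auto)
  then have "((\<lambda>s. integral {a..s} f0) has_real_derivative f0 t) (at t)"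
    using ab at_within_Icc_at[of a t b] by simp
  then have "((\<lambda>s. G a - integral {a..s} f0) has_real_derivative 0 - f0 t) (at t)"
    by (intro DERIV_diff DERIV_const)
  then have "((\<lambda>s. G a - integral {a..s} f0) has_real_derivative - f0 t) (at t)" by simp
  then have dG: "(G has_real_derivative - f0 t) (at t)"
  proof (rule has_field_derivative_transform_within_open)
    show "G a - integral {a..s} f0 = G s" if "s \<in> {a<..}" for s
      using that by (intro G[symmetric]) simp
  qed (use ab in auto)
  have "((\<lambda>s. (f1 s - G s) / s) has_real_derivative D / t) (at t)"
  proof -
    have "((\<lambda>s. (f1 s - G s) / s) has_real_derivative ((D - - f0 t) * t - (f1 t - G t) * 1) / (t * t)) (at t)"
      using \<open>0 < t\<close> by (intro DERIV_divide DERIV_diff der dG DERIV_ident) simp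
    moreover have "((D - - f0 t) * t - (f1 t - G t) * 1) / (t * t) = D / t"
    proof -
      have "f1 t - G t = t * f0 t" using f0_eq[OF \<open>0 < t\<close>] \<open>0 < t\<close> by simp
      then show ?thesis using \<open>0 < t\<close> by (simp add: field_simps)
    qed
    ultimately show ?thesis by simp
  qed
  then show ?thesis
  proof (rule has_field_derivative_transform_within_open)
    show "(f1 s - G s) / s = f0 s" if "s \<in> {0<..}" for s
      using that by (intro f0_eq[symmetric]) simp
  qed (use \<open>0 < t\<close> in auto)
qed

section \<open>Transfer of positivity\<close>

theorem mainTheorem7:
  fixes f1 f0 :: "real \<Rightarrow> real" and f :: "real \<times> real \<Rightarrow> real"
  assumes even: "\<And>x. f1 (- x) = f1 x"
    and L1: "set_integrable lebesgue {0..} f1"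
    and C0: "continuous_on {0..} f1" "(f1 \<longlongrightarrow> 0) at_top"
    and AC: "AC_loc_pos f1"
    and weighted: "set_integrable lebesgue {0<..} (\<lambda>t. (t + 1) * \<bar>deriv f1 t\<bar>)"
    and conv: "\<exists>L. ((\<lambda>\<epsilon>. LINT t:{\<epsilon>..1}|lebesgue. deriv f1 t / t) \<longlongrightarrow> L) (at_right 0)"
    and f0_pos: "\<And>t. t > 0 \<Longrightarrow> f0 t = - (LINT u:{t<..}|lebesgue. deriv f1 u / u)"
    and f0_zero: "((\<lambda>\<epsilon>. - (LINT u:{\<epsilon><..}|lebesgue. deriv f1 u / u)) \<longlongrightarrow> f0 0) (at_right 0)"
    and f: "\<And>x1 x2. f (x1, x2) = f0 (max \<bar>x1\<bar> \<bar>x2\<bar>)"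
  shows
    "(set_integrable lebesgue {0<..} f0 \<and>
      set_integrable lebesgue {0<..} (\<lambda>t. t * deriv f0 t) \<and>
      (\<forall>x. f1 x = \<bar>x\<bar> * f0 \<bar>x\<bar> + (LINT t:{\<bar>x\<bar><..}|lebesgue. f0 t)) \<and>
      (\<forall>x. f1 x = - (LINT t:{\<bar>x\<bar><..}|lebesgue. t * deriv f0 t))) \<and>
     integrable lebesgue f1 \<and> integrable lebesgue f \<and>
     ((\<forall>y. 0 \<le> fourier f1 y) \<longrightarrow> (\<forall>y. 0 \<le> fourier f y)) \<and>
     ((\<forall>y. 0 < fourier f1 y) \<and> (LINT t:{0<..}|lebesgue. t * deriv f1 t) < 0 \<longrightarrow>
        (\<forall>y. 0 < fourier f y)) \<and>
     ((\<forall>y. 0 < fourier f y) \<longrightarrow> (LINT t:{0<..}|lebesgue. t * deriv f1 t) < 0)"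
proof -
  obtain h where h[measurable]: "h \<in> borel_measurable borel" and h0': "\<forall>u\<le>0. h u = 0"
    and int_h: "integrable lborel h" and int_uh: "integrable lborel (\<lambda>u. u * h u)"
    and ae: "AE u in lebesgue. 0 < u \<longrightarrow> deriv f1 u = h u"
    and f1_rep': "\<forall>x. f1 x = - (LINT u|lborel. indicator {\<bar>x\<bar><..} u * h u)"
    by (rule borel_deriv_representation[OF even C0 AC weighted])
  note h0 = h0'[rule_format] and f1_rep = f1_rep'[rule_format]
  have f0_rep: "f0 t = - (LINT u|lborel. indicator {t<..} u * (h u / u))" if "0 < t" for t
  proof -
    have "(LINT u:{t<..}|lebesgue. deriv f1 u / u) = (LINT u|lborel. indicator {t<..} u * (h u / u))"
      unfolding set_lebesgue_integral_def
    proof (rule integral_cong_borel)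
      show "AE u in lebesgue. indicator {t<..} u *\<^sub>R (deriv f1 u / u) = indicator {t<..} u * (h u / u)"
        using ae by eventually_elim (use that in \<open>auto simp: indicator_def\<close>)
    qed measurable
    then show ?thesis using f0_pos[OF that] by simp
  qed
  have f1_rep_nonneg: "f1 x = - (LINT u|lborel. indicator {x<..} u * h u)" if "0 \<le> x" for x
    using f1_rep[of x] that by simp
  have tail: "integrable lborel (\<lambda>t. indicator {a<..} t * f0 t)"
    "f1 a = a * f0 a + (LINT t|lborel. indicator {a<..} t * f0 t)" if "0 \<le> a" for a
    by (rule tail_average[OF h h0 int_h that f1_rep_nonneg f0_rep]; assumption)+
  have lebesgue_tail: "set_integrable lebesgue {a<..} f0"
    "(LINT t:{a<..}|lebesgue. f0 t) = (LINT t|lborel. indicator {a<..} t * f0 t)" if "0 \<le> a" for a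
    using tail(1)[OF that] borel_measurable_integrable[OF tail(1)[OF that]]
    by (simp_all add: set_integrable_def set_lebesgue_integral_def integrable_completion integral_completion)
  have "AE t in lebesgue. t \<notin> {t. 0 < t \<and> \<not> f1 differentiable (at t)}"
    using AC_loc_pos_ae_differentiable[OF AC] by (intro AE_not_in) (simp add: negligible_iff_null_sets)
  with ae have ae_f0: "AE t in lebesgue. 0 < t \<longrightarrow> t * deriv f0 t = h t"
  proof eventually_elim
    case (elim t)
    show ?case
    proof
      assume t: "0 < t"
      then have "f1 differentiable (at t)" using elim by simp
      then have "(f1 has_real_derivative deriv f1 t) (at t)"
        by (simp only: DERIV_deriv_iff_real_differentiable)
      from tail_average_derivative[OF tail(2)[OF less_imp_le] tail(1)[OF order_refl] C0(1) t this]
      have "deriv f0 t = deriv f1 t / t"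
        by (simp add: DERIV_imp_deriv)
      then show "t * deriv f0 t = h t" using elim t by simp
    qed
  qed
  have int_tdf0: "set_integrable lebesgue {0<..} (\<lambda>t. t * deriv f0 t)"
  proof -
    have "AE t in lebesgue. indicator {0<..} t *\<^sub>R (t * deriv f0 t) = h t"
      using ae_f0 by eventually_elim (auto simp: indicator_def h0)
    from integrable_cong_borel[OF this] int_h show ?thesis
      by (simp add: set_integrable_def)
  qed
  have f1_f0: "f1 x = \<bar>x\<bar> * f0 \<bar>x\<bar> + (LINT t:{\<bar>x\<bar><..}|lebesgue. f0 t)" for x
    using tail(2)[of "\<bar>x\<bar>"] lebesgue_tail(2)[of "\<bar>x\<bar>"] f1_rep[of x] f1_rep[of "\<bar>x\<bar>"] by simp
  have f1_df0: "f1 x = - (LINT t:{\<bar>x\<bar><..}|lebesgue. t * deriv f0 t)" for x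
  proof -
    have "(LINT t:{\<bar>x\<bar><..}|lebesgue. t * deriv f0 t) = (LINT u|lborel. indicator {\<bar>x\<bar><..} u * h u)"
      unfolding set_lebesgue_integral_def
    proof (rule integral_cong_borel)
      show "AE t in lebesgue. indicator {\<bar>x\<bar><..} t *\<^sub>R (t * deriv f0 t) = indicator {\<bar>x\<bar><..} t * h t"
        using ae_f0 by eventually_elim (auto simp: indicator_def)
    qed measurable
    then show ?thesis using f1_rep[of x] by simp
  qed
  define \<Phi> where "\<Phi> s = - (LINT u|lborel. h u * interval_transform u s)" for s
  define \<Psi> where "\<Psi> y1 y2 = - (LINT u|lborel. h u / u * (interval_transform u y1 * interval_transform u y2))" for y1 y2
  have int_f1: "integrable lebesgue f1"
    by (rule fourier_interval_superposition(1)[OF h h0 int_uh f1_rep]; assumption)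
  have fourier_f1: "fourier f1 y = complex_of_real (\<Phi> y)" for y
    unfolding \<Phi>_def by (rule fourier_interval_superposition(2)[OF h h0 int_uh f1_rep]; assumption)
  have k: "(\<lambda>u. h u / u) \<in> borel_measurable borel" by measurable
  have k0: "h u / u = 0" if "u \<le> 0" for u using h0[OF that] by simp
  have int_k: "integrable lborel (\<lambda>u. u\<^sup>2 * (h u / u))"
  proof -
    have "u\<^sup>2 * (h u / u) = u * h u" for u by (simp add: power2_eq_square)
    then show ?thesis using int_uh by simp
  qed
  have f_rep: "f (x1, x2) = - (LINT u|lborel. indicator {max \<bar>x1\<bar> \<bar>x2\<bar><..} u * (h u / u))"
    if "(x1, x2) \<noteq> 0" for x1 x2
  proof -
    have "0 < max \<bar>x1\<bar> \<bar>x2\<bar>" using that by (auto simp: zero_prod_def max_def)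
    then show ?thesis unfolding f by (rule f0_rep)
  qed
  have int_f: "integrable lebesgue f"
    by (rule fourier_square_superposition(1)[OF k k0 int_k f_rep]; assumption)
  have fourier_f: "fourier f y = complex_of_real (\<Psi> (fst y) (snd y))" for y
    unfolding \<Psi>_def by (rule fourier_square_superposition(2)[OF k k0 int_k f_rep]; assumption)
  have axis: "\<Psi> y 0 = 2 * \<Phi> y" for y
    using square_transform_axis[OF h h0 int_h, of y] by (simp add: \<Phi>_def \<Psi>_def)
  have nonneg: "0 \<le> \<Psi> y1 y2" if "\<And>s. 0 \<le> \<Phi> s" for y1 y2
    using square_transform_nonneg[OF h h0 int_h] that unfolding \<Phi>_def \<Psi>_def by blast
  have pos: "0 < \<Psi> y1 y2" if "\<And>s. 0 < \<Phi> s" for y1 y2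
    using square_transform_pos[OF h h0 int_h] that unfolding \<Phi>_def \<Psi>_def by blast
  have moment: "\<Psi> 0 0 = - 4 * (LINT t:{0<..}|lebesgue. t * deriv f1 t)"
  proof -
    have "(LINT t:{0<..}|lebesgue. t * deriv f1 t) = (LINT u|lborel. u * h u)"
      unfolding set_lebesgue_integral_def
    proof (rule integral_cong_borel)
      show "AE t in lebesgue. indicator {0<..} t *\<^sub>R (t * deriv f1 t) = t * h t"
        using ae by eventually_elim (auto simp: indicator_def h0)
    qed measurable
    moreover have "(LINT u|lborel. h u * interval_transform u 0) = (LINT u|lborel. 2 * (u * h u))"
      by (rule Bochner_Integration.integral_cong) simp_all
    ultimately show ?thesis by (simp add: axis \<Phi>_def)
  qed
  have "(\<forall>y. 0 < fourier f y) \<longrightarrow> (LINT t:{0<..}|lebesgue. t * deriv f1 t) < 0"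
  proof
    assume "\<forall>y. 0 < fourier f y"
    then have "0 < fourier f (0, 0)" by blast
    then have "0 < \<Psi> 0 0" by (simp add: fourier_f less_complex_def)
    then show "(LINT t:{0<..}|lebesgue. t * deriv f1 t) < 0" using moment by simp
  qed
  moreover have "(\<forall>y. 0 \<le> fourier f1 y) \<longrightarrow> (\<forall>y. 0 \<le> fourier f y)"
    using nonneg by (simp add: fourier_f fourier_f1 less_eq_complex_def)
  moreover have "(\<forall>y. 0 < fourier f1 y) \<longrightarrow> (\<forall>y. 0 < fourier f y)"
    using pos by (simp add: fourier_f fourier_f1 less_complex_def)
  ultimately show ?thesis
    using lebesgue_tail(1)[of 0] int_tdf0 f1_f0 f1_df0 int_f1 int_f by simp
qed

end
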